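(* There exist absolute constants $c_3,c_4>0$ such that for $\eta\in[0,1/2)$, $\gamma=\tfrac12-\eta$, $\delta\in(0,1)$, $r\le\frac{\gamma}{c_3\sqrt d}$ and $N\ge \frac{c_4}{(r/2)^d\gamma^2}\ln\left(\frac{1}{r^d\gamma\delta}\right)$, in random-order best-response dynamics, with probability at least $1-\delta$ every sensor $i$ with $|w\cdot x_i|>2r$ updates correctly, i.e. its state after its update equals $t(x_i)$.
   Context: Sensors $1,\dots,N$ have positions $x_1,\dots,x_N$ drawn i.i.d. uniformly from the unit ball $\{x\in\mathbb{R}^d:\|x\|\le 1\}$, $d\ge1$. The target separator is the hyperplane $\{x: w\cdot x=0\}$ for a fixed unit vector $w$, and the target label of $x$ is $t(x)=\mathrm{sign}(w\cdot x)$. Noise rate $\eta$: conditional on the positions, the initial states in $\{+1,-1\}$ are independent across sensors, and sensor $i$'s initial state equals $t(x_i)$ with probability at least $1-\eta$. Distinct sensors $i\ne j$ are neighbors if $\|x_i-x_j\|\le r$. A best-response update of sensor $i$ sets its state to the majority state among its neighbors' current states (ties or no neighbors: arbitrary new state). Random-order best-response dynamics: a permutation $\pi$ of the sensors is drawn uniformly at random, independently of positions and states, and sensors $\pi(1),\dots,\pi(N)$ each perform one best-response update, one at a time, each using the states current at the time of its update. *)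

theory Defs
  imports "HOL-Probability.Probability"
begin

(* Points of R^d are represented as functions nat => real; only coordinates j < d matter.
   Lebesgue measure on R^d is the product measure of lborel over {..<d}. *)
definition Rd :: "nat \<Rightarrow> (nat \<Rightarrow> real) measure" where
  "Rd d = PiM {..<d} (\<lambda>_. lborel)"

definition dotp :: "nat \<Rightarrow> (nat \<Rightarrow> real) \<Rightarrow> (nat \<Rightarrow> real) \<Rightarrow> real" where
  "dotp d v x = (\<Sum>j<d. v j * x j)"

definition distd :: "nat \<Rightarrow> (nat \<Rightarrow> real) \<Rightarrow> (nat \<Rightarrow> real) \<Rightarrow> real" where
  "distd d x y = sqrt (\<Sum>j<d. (x j - y j)^2)"

definition unit_ball :: "nat \<Rightarrow> (nat \<Rightarrow> real) set" where
  "unit_ball d = {x \<in> space (Rd d). (\<Sum>j<d. (x j)^2) \<le> 1}"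

definition unif_ball :: "nat \<Rightarrow> (nat \<Rightarrow> real) measure" where
  "unif_ball d = uniform_measure (Rd d) (unit_ball d)"

(* target label: True encodes +1, False encodes -1; t(x) = sign(w.x) *)
definition target :: "nat \<Rightarrow> (nat \<Rightarrow> real) \<Rightarrow> (nat \<Rightarrow> real) \<Rightarrow> bool" where
  "target d w x = (dotp d w x > 0)"

definition neighbors :: "nat \<Rightarrow> real \<Rightarrow> nat \<Rightarrow> (nat \<Rightarrow> nat \<Rightarrow> real) \<Rightarrow> nat \<Rightarrow> nat set" where
  "neighbors d r N X i = {j \<in> {..<N}. j \<noteq> i \<and> distd d (X i) (X j) \<le> r}"

definition best_response ::
  "nat \<Rightarrow> real \<Rightarrow> nat \<Rightarrow> (nat \<Rightarrow> nat \<Rightarrow> real) \<Rightarrow> (nat \<Rightarrow> bool) \<Rightarrow> nat \<Rightarrow> bool \<Rightarrow> bool" where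
  "best_response d r N X s i tie =
     (let P = card {j \<in> neighbors d r N X i. s j};
          M = card {j \<in> neighbors d r N X i. \<not> s j}
      in if P > M then True else if M > P then False else tie)"

primrec brd_run ::
  "nat \<Rightarrow> real \<Rightarrow> nat \<Rightarrow> (nat \<Rightarrow> nat \<Rightarrow> real) \<Rightarrow> (nat \<Rightarrow> nat) \<Rightarrow> (nat \<Rightarrow> bool)
     \<Rightarrow> (nat \<Rightarrow> bool) \<Rightarrow> nat \<Rightarrow> (nat \<Rightarrow> bool)" where
  "brd_run d r N X prm tb s0 0 = s0"
| "brd_run d r N X prm tb s0 (Suc k) =
     (let s = brd_run d r N X prm tb s0 k; i = prm k
      in s(i := best_response d r N X s i (tb k)))"

definition good_event ::
  "nat \<Rightarrow> real \<Rightarrow> (nat \<Rightarrow> real) \<Rightarrow> nat \<Rightarrow> (nat \<Rightarrow> nat \<Rightarrow> real) \<Rightarrow> (nat \<Rightarrow> nat)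
     \<Rightarrow> (nat \<Rightarrow> bool) \<Rightarrow> (nat \<Rightarrow> bool) \<Rightarrow> bool" where
  "good_event d r w N X prm tb s0 =
     (\<forall>k<N. \<bar>dotp d w (X (prm k))\<bar> > 2 * r \<longrightarrow>
        brd_run d r N X prm tb s0 (Suc k) (prm k) = target d w (X (prm k)))"

definition state_prob ::
  "nat \<Rightarrow> (nat \<Rightarrow> real) \<Rightarrow> nat \<Rightarrow> (nat \<Rightarrow> nat \<Rightarrow> real) \<Rightarrow> (nat \<Rightarrow> real) \<Rightarrow> (nat \<Rightarrow> bool) \<Rightarrow> real" where
  "state_prob d w N X q s0 =
     (\<Prod>i<N. if s0 i = target d w (X i) then q i else 1 - q i)"

(* probability (lower integral over the positions) of the good event:
   positions i.i.d. uniform in the unit ball, initial states from the noise kernel q,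
   permutation uniform and independent; tb = tie-breaking rule, which may depend on
   positions, initial states, permutation and time step *)
definition success_prob ::
  "nat \<Rightarrow> real \<Rightarrow> (nat \<Rightarrow> real) \<Rightarrow> nat \<Rightarrow> ((nat \<Rightarrow> nat \<Rightarrow> real) \<Rightarrow> nat \<Rightarrow> real)
     \<Rightarrow> ((nat \<Rightarrow> nat \<Rightarrow> real) \<Rightarrow> (nat \<Rightarrow> bool) \<Rightarrow> (nat \<Rightarrow> nat) \<Rightarrow> nat \<Rightarrow> bool) \<Rightarrow> ennreal" where
  "success_prob d r w N q tb =
     (\<integral>\<^sup>+ X. ennreal
        (\<Sum>s0\<in>{..<N} \<rightarrow>\<^sub>E (UNIV :: bool set). \<Sum>prm\<in>{p. p permutes {..<N}}.
           state_prob d w N X (q X) s0 * (1 / fact N) *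
           (if good_event d r w N X prm (tb X s0 prm) s0 then 1 else 0))
      \<partial>(PiM {..<N} (\<lambda>_. unif_ball d)))"

end

theory Submission
  imports Defs
begin

text \<open>The positions are i.i.d., so the order of the updates may be fixed. Write \<open>u\<close> for \<open>\<bar>w \<cdot> x\<bar>\<close>
  and \<open>\<gamma> = 1/2 - \<eta>\<close>. During the first three quarters of the updates every sensor with \<open>u > r\<close> updates correctly:
  its neighbours lie on its own side, those still in their initial state are correct with probability at least
  \<open>1/2 + \<gamma>\<close>, and of those already updated a fraction of at least \<open>1/2 - \<gamma>/12\<close> has \<open>u > r\<close>
  and is correct by induction. Afterwards all neighbours of a sensor with \<open>u > 2r\<close> have \<open>u > r\<close>, and
  about three quarters of them have updated in the first phase, hence correctly. Given the position
  of the sensor, the votes of the other sensors are independent, so the deviations are controlled by exponential moments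
  and a union bound over the sensors.

  The fraction \<open>1/2 - \<gamma>/12\<close> comes from the reflection in the hyperplane through \<open>x\<close> parallel
  to the separator. It maps the near half of the neighbourhood into the far half, except for
  points in a shell of thickness \<open>O(r\<^sup>2)\<close> at the unit sphere, which occupies a
  fraction \<open>O(r \<surd>d)\<close> of the neighbourhood.\<close>

section \<open>Reflections and dilations of Lebesgue measure\<close>

text \<open>The constant \<open>c\<close> is the reciprocal of the modulus of the Jacobian
  determinant. Stated for nonnegative integrals, the change of variables composes and can be
  verified one coordinate at a time.\<close>

definition scales :: "'a measure \<Rightarrow> real \<Rightarrow> ('a \<Rightarrow> 'a) \<Rightarrow> bool" where
  "scales M c T \<longleftrightarrow> T \<in> measurable M M \<and>
     (\<forall>f\<in>borel_measurable M. (\<integral>\<^sup>+y. f (T y) \<partial>M) = ennreal c * (\<integral>\<^sup>+y. f y \<partial>M))"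

lemma scalesD:
  assumes "scales M c T"
  shows "T \<in> measurable M M"
    and "f \<in> borel_measurable M \<Longrightarrow> (\<integral>\<^sup>+y. f (T y) \<partial>M) = ennreal c * (\<integral>\<^sup>+y. f y \<partial>M)"
  using assms by (auto simp: scales_def)

lemma scales_emeasure:
  assumes "scales M c T" "A \<in> sets M"
  shows "emeasure M (T -` A \<inter> space M) = ennreal c * emeasure M A"
proof -
  have "emeasure M (T -` A \<inter> space M) = (\<integral>\<^sup>+y. indicator (T -` A \<inter> space M) y \<partial>M)"
    using measurable_sets[OF scalesD(1)[OF assms(1)] assms(2)] by simp
  also have "\<dots> = (\<integral>\<^sup>+y. indicator A (T y) \<partial>M)"
    by (rule nn_integral_cong) (auto split: split_indicator)
  also have "\<dots> = ennreal c * (\<integral>\<^sup>+y. indicator A y \<partial>M)"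
    by (rule scalesD(2)[OF assms(1)]) (use assms(2) in simp)
  finally show ?thesis using assms(2) by simp
qed

lemma scales_comp:
  assumes "scales M c T" "scales M c' T'" "c \<ge> 0" "c' \<ge> 0"
  shows "scales M (c * c') (\<lambda>y. T (T' y))"
  unfolding scales_def
proof (intro conjI ballI)
  show "(\<lambda>y. T (T' y)) \<in> measurable M M"
    using measurable_comp[OF scalesD(1)[OF assms(2)] scalesD(1)[OF assms(1)]] by (simp add: comp_def)
  fix f :: "'a \<Rightarrow> ennreal" assume f: "f \<in> borel_measurable M"
  have "(\<lambda>y. f (T y)) \<in> borel_measurable M"
    using measurable_comp[OF scalesD(1)[OF assms(1)] f] by (simp add: comp_def)
  from scalesD(2)[OF assms(2) this] scalesD(2)[OF assms(1) f]
  show "(\<integral>\<^sup>+y. f (T (T' y)) \<partial>M) = ennreal (c * c') * (\<integral>\<^sup>+y. f y \<partial>M)"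
    using assms(3,4) by (simp add: ennreal_mult ac_simps)
qed

lemma scales_cong:
  assumes "scales M c T" "\<And>y. y \<in> space M \<Longrightarrow> T y = T' y"
  shows "scales M c T'"
  unfolding scales_def
proof (intro conjI ballI)
  show "T' \<in> measurable M M"
    using scalesD(1)[OF assms(1)] measurable_cong[of M T T'] assms(2) by blast
  fix f :: "'a \<Rightarrow> ennreal" assume f: "f \<in> borel_measurable M"
  have "(\<integral>\<^sup>+y. f (T' y) \<partial>M) = (\<integral>\<^sup>+y. f (T y) \<partial>M)"
    by (rule nn_integral_cong) (simp add: assms(2))
  then show "(\<integral>\<^sup>+y. f (T' y) \<partial>M) = ennreal c * (\<integral>\<^sup>+y. f y \<partial>M)"
    using scalesD(2)[OF assms(1) f] by simp
qed

text \<open>Tonelli with the \<open>j\<close>-th coordinate innermost: once the other coordinates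
  are fixed, \<open>g\<close> is a constant and the map is a one-dimensional affine
  substitution.\<close>

lemma scales_coordinate:
  fixes g :: "(nat \<Rightarrow> real) \<Rightarrow> real"
  assumes "finite I" "j \<in> I" "a \<noteq> 0"
    and g: "g \<in> borel_measurable (PiM I (\<lambda>_. lborel))"
    and indep: "\<And>y c. g (y(j := c)) = g y"
  shows "scales (PiM I (\<lambda>_. lborel)) (1 / \<bar>a\<bar>) (\<lambda>y. y(j := a * y j + g y))"
  unfolding scales_def
proof (intro conjI ballI)
  interpret lb: product_sigma_finite "\<lambda>_::nat. lborel :: real measure" by standard
  let ?M = "PiM I (\<lambda>_. lborel :: real measure)"
  let ?T = "\<lambda>y. y(j := a * y j + g y)"
  show T: "?T \<in> measurable ?M ?M"
  proof (rule measurable_PiM_single')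
    fix i assume i: "i \<in> I"
    have "(\<lambda>y. y i) \<in> borel_measurable ?M" "(\<lambda>y. y j) \<in> borel_measurable ?M"
      using measurable_component_singleton[OF i, of "\<lambda>_. lborel"] measurable_component_singleton[OF assms(2), of "\<lambda>_. lborel"] by simp_all
    then show "(\<lambda>y. ?T y i) \<in> ?M \<rightarrow>\<^sub>M lborel"
      using g by (cases "i = j") auto
  next
    show "?T \<in> space ?M \<rightarrow> (\<Pi>\<^sub>E i\<in>I. space lborel)"
      using assms(2) by (auto simp: space_PiM PiE_def extensional_def)
  qed
  fix f :: "(nat \<Rightarrow> real) \<Rightarrow> ennreal" assume f: "f \<in> borel_measurable ?M"
  define J where "J = I - {j}"
  have I: "I = insert j J" "j \<notin> J" "finite J" using assms(1,2) by (auto simp: J_def)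
  have meas: "(\<lambda>y. f (?T y)) \<in> borel_measurable ?M"
    using measurable_comp[OF T f] by (simp add: comp_def)
  have "(\<integral>\<^sup>+y. f (?T y) \<partial>?M) = (\<integral>\<^sup>+x. \<integral>\<^sup>+y. f (?T (x(j := y))) \<partial>lborel \<partial>PiM J (\<lambda>_. lborel))"
    unfolding I(1) by (rule lb.product_nn_integral_insert[OF I(3,2) meas[unfolded I(1)]])
  also have "\<dots> = (\<integral>\<^sup>+x. ennreal (1 / \<bar>a\<bar>) * (\<integral>\<^sup>+y. f (x(j := y)) \<partial>lborel) \<partial>PiM J (\<lambda>_. lborel))"
  proof (rule nn_integral_cong)
    fix x assume x: "x \<in> space (PiM J (\<lambda>_. lborel :: real measure))"
    have m: "(\<lambda>y. f (x(j := y))) \<in> borel_measurable borel"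
    proof -
      have "(\<lambda>y. x(j := y)) \<in> measurable lborel ?M"
        unfolding I(1) by (rule measurable_component_update[OF x I(2)])
      from measurable_comp[OF this f] show ?thesis by (simp add: comp_def)
    qed
    have "(\<integral>\<^sup>+y. f (x(j := y)) \<partial>lborel) = ennreal \<bar>a\<bar> * (\<integral>\<^sup>+y. f (x(j := g x + a * y)) \<partial>lborel)"
      by (rule nn_integral_real_affine[OF m assms(3)])
    then show "(\<integral>\<^sup>+y. f (?T (x(j := y))) \<partial>lborel) = ennreal (1 / \<bar>a\<bar>) * (\<integral>\<^sup>+y. f (x(j := y)) \<partial>lborel)"
      using assms(3) by (simp add: indep add.commute mult.assoc[symmetric] ennreal_mult[symmetric])
  qed
  also have "\<dots> = ennreal (1 / \<bar>a\<bar>) * (\<integral>\<^sup>+x. (\<integral>\<^sup>+y. f (x(j := y)) \<partial>lborel) \<partial>PiM J (\<lambda>_. lborel))"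
  proof (rule nn_integral_cmult)
    have "(\<lambda>(x, y). f (x(j := y))) \<in> borel_measurable (PiM J (\<lambda>_. lborel) \<Otimes>\<^sub>M lborel)"
      using measurable_comp[OF measurable_add_dim[of j J "\<lambda>_. lborel"] f[unfolded I(1)]]
      by (simp add: comp_def case_prod_beta)
    from lborel.borel_measurable_nn_integral[OF this] show "(\<lambda>x. \<integral>\<^sup>+y. f (x(j := y)) \<partial>lborel) \<in> borel_measurable (PiM J (\<lambda>_. lborel))"
      by simp
  qed
  also have "(\<integral>\<^sup>+x. (\<integral>\<^sup>+y. f (x(j := y)) \<partial>lborel) \<partial>PiM J (\<lambda>_. lborel)) = (\<integral>\<^sup>+y. f y \<partial>?M)"
    unfolding I(1) by (rule lb.product_nn_integral_insert[OF I(3,2) f[unfolded I(1)], symmetric])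
  finally show "(\<integral>\<^sup>+y. f (?T y) \<partial>?M) = ennreal (1 / \<bar>a\<bar>) * (\<integral>\<^sup>+y. f y \<partial>?M)" .
qed

text \<open>The map is a composition of one-coordinate maps, built up over subsets \<open>K\<close>
  of \<open>J\<close>. Since no \<open>g i\<close> looks at coordinates in \<open>J\<close>,
  changing one of them does not disturb the remaining steps.\<close>

lemma scales_coordinates:
  fixes g :: "nat \<Rightarrow> (nat \<Rightarrow> real) \<Rightarrow> real"
  assumes fin: "finite I" and JI: "J \<subseteq> I" and a: "\<And>i. i \<in> J \<Longrightarrow> a i \<noteq> 0"
    and g: "\<And>i. i \<in> J \<Longrightarrow> g i \<in> borel_measurable (PiM I (\<lambda>_. lborel))"
    and indep: "\<And>i y y'. i \<in> J \<Longrightarrow> (\<And>k. k \<notin> J \<Longrightarrow> y k = y' k) \<Longrightarrow> g i y = g i y'"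
  shows "scales (PiM I (\<lambda>_. lborel)) (\<Prod>i\<in>J. 1 / \<bar>a i\<bar>) (\<lambda>y i. if i \<in> J then a i * y i + g i y else y i)"
proof -
  let ?M = "PiM I (\<lambda>_. lborel :: real measure)"
  have "finite J" using fin JI finite_subset by blast
  have "K \<subseteq> J \<longrightarrow> scales ?M (\<Prod>i\<in>K. 1 / \<bar>a i\<bar>) (\<lambda>y i. if i \<in> K then a i * y i + g i y else y i)"
    if "finite K" for K
    using that
  proof (induction K rule: finite_induct)
    case empty
    show ?case by (simp add: scales_def measurable_ident_sets[OF refl] one_ennreal_def[symmetric])
  next
    case (insert j K)
    show ?case
    proof
      assume sub: "insert j K \<subseteq> J"
      then have jJ: "j \<in> J" by auto
      have 1: "scales ?M (1 / \<bar>a j\<bar>) (\<lambda>y. y(j := a j * y j + g j y))"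
      proof (rule scales_coordinate)
        show "g j (y(j := c)) = g j y" for y c
          by (rule indep[OF jJ]) (use jJ in auto)
      qed (use fin JI jJ a g in auto)
      have 2: "scales ?M (\<Prod>i\<in>K. 1 / \<bar>a i\<bar>) (\<lambda>y i. if i \<in> K then a i * y i + g i y else y i)"
        using insert.IH sub by auto
      have eq: "(\<Prod>i\<in>insert j K. 1 / \<bar>a i\<bar>) = (\<Prod>i\<in>K. 1 / \<bar>a i\<bar>) * (1 / \<bar>a j\<bar>)"
        using insert.hyps by (simp add: mult.commute)
      show "scales ?M (\<Prod>i\<in>insert j K. 1 / \<bar>a i\<bar>) (\<lambda>y i. if i \<in> insert j K then a i * y i + g i y else y i)"
        unfolding eq
      proof (rule scales_cong[OF scales_comp[OF 2 1]])
        fix y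
        have "g i (y(j := a j * y j + g j y)) = g i y" if "i \<in> K" for i
          by (rule indep) (use that sub jJ in auto)
        then show "(\<lambda>i. if i \<in> K then a i * (y(j := a j * y j + g j y)) i + g i (y(j := a j * y j + g j y))
             else (y(j := a j * y j + g j y)) i) = (\<lambda>i. if i \<in> insert j K then a i * y i + g i y else y i)"
          using insert.hyps by (auto simp: fun_eq_iff)
      qed (auto intro: prod_nonneg)
    qed
  qed
  from this[OF \<open>finite J\<close>] show ?thesis by simp
qed

section \<open>Affine maps and reflections of \<open>Rd d\<close>\<close>

lemma dotp_measurable [measurable]: "dotp d w \<in> borel_measurable (Rd d)"
proof -
  have "(\<lambda>y. \<Sum>j<d. w j * y j) \<in> borel_measurable (Rd d)"
  proof (rule borel_measurable_sum)
    fix j assume "j \<in> {..<d}"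
    from measurable_component_singleton[OF this, of "\<lambda>_. lborel"]
    show "(\<lambda>y. w j * y j) \<in> borel_measurable (Rd d)" unfolding Rd_def by (intro borel_measurable_times borel_measurable_const) simp_all
  qed
  then show ?thesis by (simp add: dotp_def[abs_def])
qed

text \<open>Used for contractions towards a point. Restricting to \<open>{..<d}\<close> is
  consistent with leaving other arguments alone, because points of \<open>Rd d\<close> are
  \<open>undefined\<close> there.\<close>

lemma scales_affine:
  assumes "a > 0"
  shows "scales (Rd d) ((1 / a) ^ d) (\<lambda>y. \<lambda>i\<in>{..<d}. a * y i + b i)"
proof -
  have "scales (Rd d) (\<Prod>i\<in>{..<d}. 1 / \<bar>a\<bar>) (\<lambda>y i. if i \<in> {..<d} then a * y i + b i else y i)"
    unfolding Rd_def by (rule scales_coordinates) (use assms in auto)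
  then have "scales (Rd d) ((1 / a) ^ d) (\<lambda>y i. if i \<in> {..<d} then a * y i + b i else y i)"
    using assms by simp
  then show ?thesis
  proof (rule scales_cong)
    fix y assume "y \<in> space (Rd d)"
    then have "y i = undefined" if "\<not> i < d" for i
      using that unfolding Rd_def space_PiM by (intro PiE_arb[where S="{..<d}"]) auto
    then show "(\<lambda>i. if i \<in> {..<d} then a * y i + b i else y i) = (\<lambda>i\<in>{..<d}. a * y i + b i)"
      by (intro ext) simp
  qed
qed

definition refl_map :: "nat \<Rightarrow> (nat \<Rightarrow> real) \<Rightarrow> real \<Rightarrow> (nat \<Rightarrow> real) \<Rightarrow> nat \<Rightarrow> real" where
  "refl_map d w c y = (\<lambda>i\<in>{..<d}. y i - 2 * (dotp d w y - c) * w i)"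

text \<open>Writing \<open>j\<close> for a coordinate with \<open>w j \<noteq> 0\<close>, the shear \<open>S\<close> replaces the coordinate \<open>y j\<close> by
  \<open>(w \<cdot> y - c) / w j\<close>; in the new coordinates the reflection is a shear \<open>A\<close> of the
  other coordinates followed by the sign change \<open>N\<close> of the \<open>j\<close>-th one.\<close>

lemma scales_reflection:
  assumes w: "(\<Sum>j<d. (w j)^2) = 1"
  shows "scales (Rd d) 1 (refl_map d w c)"
proof -
  obtain j where j: "j < d" "w j \<noteq> 0"
    using w by (metis (no_types, lifting) lessThan_iff power_zero_numeral sum.neutral zero_neq_one)
  define h where "h y = (\<Sum>i\<in>{..<d} - {j}. w i * y i) - c" for y :: "nat \<Rightarrow> real"
  have split: "dotp d w y = w j * y j + (\<Sum>i\<in>{..<d} - {j}. w i * y i)" for y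
    using j by (simp add: dotp_def sum.remove[of "{..<d}" j])
  have comp: "(\<lambda>y. y i) \<in> borel_measurable (Rd d)" if "i < d" for i
    using measurable_component_singleton[of i "{..<d}" "\<lambda>_. lborel"] that unfolding Rd_def by simp
  have hm: "h \<in> borel_measurable (Rd d)"
    unfolding h_def[abs_def] by (intro borel_measurable_diff borel_measurable_sum borel_measurable_times borel_measurable_const comp) auto
  have hind: "h y = h y'" if "\<And>k. k \<notin> {j} \<Longrightarrow> y k = y' k" for y y'
    using that by (auto simp: h_def intro!: sum.cong)
  let ?S = "\<lambda>y i. if i \<in> {j} then 1 * y i + h y / w j else y i"
  \<comment> \<open>\<open>?S'\<close> undoes \<open>?S\<close>, because \<open>h\<close> does not
    depend on coordinate \<open>j\<close>.\<close>
  let ?S' = "\<lambda>y i. if i \<in> {j} then 1 * y i + (- h y / w j) else y i"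
  let ?N = "\<lambda>y i. if i \<in> {j} then (-1) * y i + 0 else (y i :: real)"
  let ?A = "\<lambda>y i. if i \<in> {..<d} - {j} then 1 * y i + (- 2 * w j * w i * y j) else y i"
  have S: "scales (Rd d) (\<Prod>i\<in>{j}. 1 / \<bar>1\<bar>) ?S"
    unfolding Rd_def
  proof (rule scales_coordinates)
    show "(\<lambda>y. h y / w j) \<in> borel_measurable (PiM {..<d} (\<lambda>_. lborel))" for i :: nat
      using hm unfolding Rd_def by simp
    show "h y / w j = h y' / w j" if "\<And>k. k \<notin> {j} \<Longrightarrow> y k = y' k" for y y'
      using hind[OF that] by simp
  qed (use j in auto)
  have S': "scales (Rd d) (\<Prod>i\<in>{j}. 1 / \<bar>1\<bar>) ?S'"
    unfolding Rd_def
  proof (rule scales_coordinates)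
    show "(\<lambda>y. - h y / w j) \<in> borel_measurable (PiM {..<d} (\<lambda>_. lborel))" for i :: nat
      using hm unfolding Rd_def by simp
    show "- h y / w j = - h y' / w j" if "\<And>k. k \<notin> {j} \<Longrightarrow> y k = y' k" for y y'
      using hind[OF that] by simp
  qed (use j in auto)
  have N: "scales (Rd d) (\<Prod>i\<in>{j}. 1 / \<bar>-1\<bar>) ?N"
    unfolding Rd_def by (rule scales_coordinates) (use j in auto)
  have A: "scales (Rd d) (\<Prod>i\<in>{..<d} - {j}. 1 / \<bar>1\<bar>) ?A"
    unfolding Rd_def
  proof (rule scales_coordinates)
    show "(\<lambda>y. - 2 * w j * w i * y j) \<in> borel_measurable (PiM {..<d} (\<lambda>_. lborel))" for i
      using comp[OF j(1)] unfolding Rd_def by (intro borel_measurable_times borel_measurable_const)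
  qed auto
  have "scales (Rd d) 1 (\<lambda>y. ?S' (?N (?A (?S y))))"
    using scales_comp[OF S' scales_comp[OF N scales_comp[OF A S]]] by simp
  then show ?thesis
  proof (rule scales_cong)
    fix y assume y: "y \<in> space (Rd d)"
    define z where "z = (dotp d w y - c) / w j"
    have zj: "y j + h y / w j = z" using j by (simp add: z_def split h_def field_simps)
    have zz: "dotp d w y - c = w j * z" using j by (simp add: z_def)
    have sq: "(\<Sum>i\<in>{..<d} - {j}. (w i)^2) = 1 - (w j)^2"
      using w j by (simp add: sum.remove[of "{..<d}" j])
    \<comment> \<open>\<open>?A\<close> moves the other coordinates along \<open>w\<close>, and
      these contribute only \<open>1 - (w j)^2\<close> to the squared norm of
      \<open>w\<close>.\<close>
    have hh: "h (?N (?A (?S y))) = h y - 2 * w j * z * (1 - (w j)^2)"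
    proof -
      have "h (?N (?A (?S y))) = (\<Sum>i\<in>{..<d} - {j}. w i * (y i - 2 * w j * w i * z)) - c"
        unfolding h_def[of "?N (?A (?S y))"] using zj by (auto intro!: sum.cong)
      also have "\<dots> = (\<Sum>i\<in>{..<d} - {j}. w i * y i - 2 * w j * z * (w i)^2) - c"
        by (simp add: algebra_simps power2_eq_square)
      also have "\<dots> = h y - 2 * w j * z * (1 - (w j)^2)"
        by (simp add: h_def sum_subtractf sum_distrib_left[symmetric] sq)
      finally show ?thesis .
    qed
    show "?S' (?N (?A (?S y))) = refl_map d w c y"
    proof
      fix i
      consider "i = j" | "i \<noteq> j" "i < d" | "\<not> i < d" by blast
      then show "?S' (?N (?A (?S y))) i = refl_map d w c y i"
      proof cases
        case 1
        have eq: "?S' (?N (?A (?S y))) i = - z - (h y - 2 * w j * z * (1 - (w j)^2)) / w j"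
          using 1 hh zj by (simp add: diff_divide_distrib)
        have hy: "h y = w j * (z - y j)"
          using zj[symmetric] j by (simp add: field_simps)
        note eq
        also have "- z - (h y - 2 * w j * z * (1 - (w j)^2)) / w j
            = - z - (w j * (z - y j) - 2 * w j * z * (1 - (w j)^2)) / w j"
          by (simp only: hy)
        also have "\<dots> = y j - 2 * (w j * z) * w j"
          using j by (simp add: field_simps power2_eq_square)
        finally show ?thesis using 1 j by (simp add: refl_map_def zz)
      next
        case 2
        then show ?thesis using zj by (simp add: refl_map_def zz)
      next
        case 3
        moreover have "y i = undefined"
          using y 3 unfolding Rd_def space_PiM by (intro PiE_arb[where S="{..<d}"]) auto
        ultimately show ?thesis using j by (simp add: refl_map_def)
      qed
    qed
  qed
qed

section \<open>Neighbourhoods of a point of the unit ball\<close>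

lemma sum_lincomb_sq:
  fixes u v :: "nat \<Rightarrow> real"
  shows "(\<Sum>j<d. (p * u j + q * v j)^2)
    = p^2 * (\<Sum>j<d. (u j)^2) + 2 * p * q * (\<Sum>j<d. u j * v j) + q^2 * (\<Sum>j<d. (v j)^2)"
proof -
  have "(\<Sum>j<d. (p * u j + q * v j)^2) = (\<Sum>j<d. p^2 * (u j)^2 + 2 * p * q * (u j * v j) + q^2 * (v j)^2)"
    by (rule sum.cong) (auto simp: power2_eq_square algebra_simps)
  then show ?thesis by (simp add: sum.distrib sum_distrib_left)
qed

text \<open>Ensures that contractions towards a point of the unit ball do not leave the
  ball.\<close>

lemma sum_convex_sq:
  fixes u v :: "nat \<Rightarrow> real"
  assumes "0 \<le> t" "t \<le> 1" "(\<Sum>j<d. (u j)^2) \<le> 1" "(\<Sum>j<d. (v j)^2) \<le> 1"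
  shows "(\<Sum>j<d. ((1 - t) * u j + t * v j)^2) \<le> 1"
proof -
  have "(\<Sum>j<d. ((1 - t) * u j + t * v j)^2) \<le> (\<Sum>j<d. (1 - t) * (u j)^2 + t * (v j)^2)"
  proof (rule sum_mono)
    fix j
    have "(1 - t) * (u j)^2 + t * (v j)^2 - ((1 - t) * u j + t * v j)^2 = t * (1 - t) * (u j - v j)^2"
      by (simp add: power2_eq_square algebra_simps)
    also have "\<dots> \<ge> 0" using assms by auto
    finally show "((1 - t) * u j + t * v j)^2 \<le> (1 - t) * (u j)^2 + t * (v j)^2" by simp
  qed
  also have "\<dots> = (1 - t) * (\<Sum>j<d. (u j)^2) + t * (\<Sum>j<d. (v j)^2)"
    by (simp add: sum.distrib sum_distrib_left)
  also have "\<dots> \<le> (1 - t) * 1 + t * 1"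
    using assms by (intro add_mono mult_left_mono) auto
  finally show ?thesis by simp
qed

lemma distd_le_iff:
  assumes "r \<ge> 0"
  shows "distd d x y \<le> r \<longleftrightarrow> (\<Sum>j<d. (y j - x j)^2) \<le> r^2"
proof -
  have "(\<Sum>j<d. (x j - y j)^2) = (\<Sum>j<d. (y j - x j)^2)"
    by (simp add: power2_commute)
  then show ?thesis
    using assms by (metis abs_of_nonneg distd_def real_sqrt_le_iff real_sqrt_abs)
qed

text \<open>Cauchy-Schwarz. It follows that the neighbours of a sensor farther than \<open>r\<close>
  from the separator lie on its side of it.\<close>

lemma dotp_diff_le_distd:
  assumes "(\<Sum>j<d. (w j)^2) = 1" "r \<ge> 0" "distd d x y \<le> r"
  shows "\<bar>dotp d w y - dotp d w x\<bar> \<le> r"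
proof -
  have "dotp d w y - dotp d w x = (\<Sum>j<d. w j * (y j - x j))"
    by (simp add: dotp_def sum_subtractf[symmetric] algebra_simps)
  also have "\<dots>^2 \<le> (\<Sum>j<d. (w j)^2) * (\<Sum>j<d. (y j - x j)^2)"
    by (rule Cauchy_Schwarz_ineq_sum)
  also have "\<dots> \<le> r^2"
    using assms distd_le_iff[of r d x y] by simp
  finally show ?thesis using assms(2) by (simp add: abs_le_square_iff[symmetric])
qed

section \<open>Measurability, and the volume of the unit ball\<close>

lemma component_measurable: "i < d \<Longrightarrow> (\<lambda>y. y i) \<in> borel_measurable (Rd d)"
  using measurable_component_singleton[of i "{..<d}" "\<lambda>_. lborel"] unfolding Rd_def by simp

lemma sum_sq_measurable [measurable]: "(\<lambda>y. \<Sum>j<d. (y j - x j)^2) \<in> borel_measurable (Rd d)"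
  by (intro borel_measurable_sum borel_measurable_power borel_measurable_diff
      borel_measurable_const component_measurable) auto

lemma sum_sq_measurable0 [measurable]: "(\<lambda>y. \<Sum>j<d. (y j)^2) \<in> borel_measurable (Rd d)"
  using sum_sq_measurable[where x="\<lambda>_. 0"] by simp

lemma unit_ball_sets [measurable]: "unit_ball d \<in> sets (Rd d)"
  unfolding unit_ball_def by measurable

text \<open>The ball contains a cube of side \<open>1 / d\<close> with a corner at the origin and is
  contained in the cube of side 2 around the origin. This makes \<open>unif_ball d\<close> a
  probability measure.\<close>

lemma emeasure_unit_ball:
  assumes "d \<ge> 1"
  shows "emeasure (Rd d) (unit_ball d) > 0" "emeasure (Rd d) (unit_ball d) < \<infinity>"
proof -
  interpret product_sigma_finite "\<lambda>_::nat. lborel :: real measure" by standard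
  have box: "emeasure (Rd d) (PiE {..<d} (\<lambda>_. {a..b})) = ennreal ((b - a) ^ d)" if "a \<le> b" for a b
    unfolding Rd_def using that by (simp add: emeasure_PiM prod_ennreal ennreal_power)
  have boxs: "PiE {..<d} (\<lambda>_. {a..b}) \<in> sets (Rd d)" for a b :: real
    unfolding Rd_def by (rule sets_PiM_I_finite) auto
  have "PiE {..<d} (\<lambda>_. {0..1 / real d}) \<subseteq> unit_ball d"
  proof
    fix y assume y: "y \<in> PiE {..<d} (\<lambda>_. {0..1 / real d})"
    have "(\<Sum>j<d. (y j)^2) \<le> (\<Sum>j<d. (1 / real d)^2)"
    proof (intro sum_mono power_mono)
      fix j assume "j \<in> {..<d}"
      from PiE_mem[OF y this] show "y j \<le> 1 / real d" "0 \<le> y j" by simp_all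
    qed
    also have "\<dots> \<le> 1" using assms by (simp add: power2_eq_square)
    finally have "(\<Sum>j<d. (y j)^2) \<le> 1" .
    moreover have "y \<in> space (Rd d)" using sets.sets_into_space[OF boxs] y by blast
    ultimately show "y \<in> unit_ball d" by (simp add: unit_ball_def)
  qed
  from emeasure_mono[OF this unit_ball_sets]
  have "ennreal ((1 / real d - 0) ^ d) \<le> emeasure (Rd d) (unit_ball d)"
    by (subst (asm) box) simp_all
  moreover have "0 < ennreal ((1 / real d - 0) ^ d)" using assms by simp
  ultimately show "emeasure (Rd d) (unit_ball d) > 0" by (rule less_le_trans[rotated])
  have "unit_ball d \<subseteq> PiE {..<d} (\<lambda>_. {-1..1})"
  proof
    fix y assume y: "y \<in> unit_ball d"
    have "y j \<in> {-1..1}" if "j < d" for j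
    proof -
      have "(y j)^2 \<le> (\<Sum>j<d. (y j)^2)"
        by (rule member_le_sum) (use that in auto)
      also have "\<dots> \<le> 1" using y by (simp add: unit_ball_def)
      finally show ?thesis by (simp add: abs_square_le_1 abs_le_iff)
    qed
    moreover have "y \<in> extensional {..<d}" using y by (simp add: unit_ball_def Rd_def space_PiM PiE_def)
    ultimately show "y \<in> PiE {..<d} (\<lambda>_. {-1..1})" by (intro PiE_I) (auto simp: extensional_def)
  qed
  from emeasure_mono[OF this boxs] show "emeasure (Rd d) (unit_ball d) < \<infinity>"
    using le_less_trans[OF _ ennreal_less_top] by (simp add: box)
qed

section \<open>Volumes of neighbourhoods and of their parts near the unit sphere\<close>

definition nbhd :: "nat \<Rightarrow> real \<Rightarrow> (nat \<Rightarrow> real) \<Rightarrow> (nat \<Rightarrow> real) set" where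
  "nbhd d r x = {y \<in> unit_ball d. distd d x y \<le> r}"

lemma nbhd_eq:
  "r \<ge> 0 \<Longrightarrow> nbhd d r x = {y \<in> space (Rd d). (\<Sum>j<d. (y j)^2) \<le> 1 \<and> (\<Sum>j<d. (y j - x j)^2) \<le> r^2}"
  by (auto simp: nbhd_def unit_ball_def distd_le_iff)

lemma nbhd_sets [measurable]: "r \<ge> 0 \<Longrightarrow> nbhd d r x \<in> sets (Rd d)"
  unfolding nbhd_eq by measurable

lemma fmeasurable_unit_ball_subset:
  assumes "d \<ge> 1" "A \<in> sets (Rd d)" "A \<subseteq> unit_ball d"
  shows "A \<in> fmeasurable (Rd d)"
  using assms emeasure_unit_ball(2)[OF assms(1)] emeasure_mono[OF assms(3) unit_ball_sets]
  by (intro fmeasurableI) auto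

lemma measure_scales:
  assumes "scales (Rd d) c T" "A \<in> sets (Rd d)" "c \<ge> 0"
  shows "measure (Rd d) (T -` A \<inter> space (Rd d)) = c * measure (Rd d) A"
  using scales_emeasure[OF assms(1,2)] assms(3) by (simp add: measure_def enn2real_mult)

text \<open>The unit ball is contracted towards \<open>x\<close> into the neighbourhood of \<open>x\<close>.\<close>

lemma measure_nbhd_ge:
  assumes d: "d \<ge> 1" and r: "0 < r" "r \<le> 1" and x: "x \<in> unit_ball d"
  shows "measure (Rd d) (nbhd d r x) \<ge> (r/2)^d * measure (Rd d) (unit_ball d)"
proof -
  \<comment> \<open>\<open>T\<close> is the inverse of the contraction by \<open>r/2\<close> towards
    \<open>x\<close>, so the contracted ball is the preimage of the ball under \<open>T\<close>. The
    ratio \<open>r/2\<close> fits because two points of the ball are at distance at most 2.\<close>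
  define T where "T = (\<lambda>y. \<lambda>i\<in>{..<d}. (2 / r) * y i + (1 - 2 / r) * x i)"
  have T: "scales (Rd d) ((1 / (2 / r)) ^ d) T"
    unfolding T_def by (rule scales_affine) (use r in auto)
  have x1: "(\<Sum>j<d. (x j)^2) \<le> 1" using x by (simp add: unit_ball_def)
  have "T -` unit_ball d \<inter> space (Rd d) \<subseteq> nbhd d r x"
  proof
    fix z assume z: "z \<in> T -` unit_ball d \<inter> space (Rd d)"
    define y where "y = T z"
    have y1: "(\<Sum>j<d. (y j)^2) \<le> 1" using z by (simp add: y_def unit_ball_def)
    have zy: "z j = (1 - r/2) * x j + (r/2) * y j" if "j < d" for j
      using that r by (simp add: y_def T_def field_simps)
    have "(\<Sum>j<d. (z j)^2) \<le> 1"
      using sum_convex_sq[of "r/2" x d y] r x1 y1 zy by simp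
    moreover have "(\<Sum>j<d. (z j - x j)^2) \<le> r^2"
    proof -
      have "(\<Sum>j<d. (z j - x j)^2) = (\<Sum>j<d. (r/2)^2 * (1 * y j + (-1) * x j)^2)"
        by (rule sum.cong) (auto simp: zy power2_eq_square algebra_simps)
      also have "\<dots> = (r/2)^2 * (\<Sum>j<d. (1 * y j + (-1) * x j)^2)"
        by (simp only: sum_distrib_left)
      also have "(\<Sum>j<d. (1 * y j + (-1) * x j)^2) \<le> 4"
      proof -
        \<comment> \<open>The parallelogram identity: adding the squared norm of
          \<open>y + x\<close> gives twice the sum of the squared norms of \<open>x\<close> and
          \<open>y\<close>.\<close>
        have "(\<Sum>j<d. (1 * y j + (-1) * x j)^2) \<le> (\<Sum>j<d. (1 * y j + (-1) * x j)^2) + (\<Sum>j<d. (1 * y j + 1 * x j)^2)"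
          by (simp add: sum_nonneg)
        also have "\<dots> \<le> 4" unfolding sum_lincomb_sq using x1 y1 by simp
        finally show ?thesis .
      qed
      finally show ?thesis by (simp add: power_divide mult_left_mono)
    qed
    ultimately show "z \<in> nbhd d r x" using z r by (auto simp: nbhd_eq)
  qed
  then have "measure (Rd d) (T -` unit_ball d \<inter> space (Rd d)) \<le> measure (Rd d) (nbhd d r x)"
    using r by (intro measure_mono_fmeasurable fmeasurable_unit_ball_subset d
        measurable_sets[OF scalesD(1)[OF T]] nbhd_sets unit_ball_sets) (auto simp: nbhd_def)
  then show ?thesis using measure_scales[OF T unit_ball_sets] r by simp
qed

text \<open>The points that a reflection may push out of the ball: for a point within
  \<open>r\<close> of a hyperplane at distance at most \<open>2 * r\<close> from the origin,
  reflection away from the origin raises the squared norm by at most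
  \<open>4 * r * (2 * r) = 8 * r^2\<close>.\<close>

definition shell :: "nat \<Rightarrow> real \<Rightarrow> (nat \<Rightarrow> real) \<Rightarrow> (nat \<Rightarrow> real) set" where
  "shell d r x = {y \<in> nbhd d r x. 1 - 8 * r^2 < (\<Sum>j<d. (y j)^2)}"

lemma shell_eq:
  "r \<ge> 0 \<Longrightarrow> shell d r x = {y \<in> space (Rd d). (\<Sum>j<d. (y j)^2) \<le> 1 \<and> (\<Sum>j<d. (y j - x j)^2) \<le> r^2
     \<and> 1 - 8 * r^2 < (\<Sum>j<d. (y j)^2)}"
  by (auto simp: shell_def nbhd_eq)

lemma shell_sets [measurable]: "r \<ge> 0 \<Longrightarrow> shell d r x \<in> sets (Rd d)"
  unfolding shell_eq by measurable

text \<open>Both bounds come from expanding the squared distance of \<open>x\<close> and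
  \<open>y\<close>. They control how a translation of \<open>y\<close> along \<open>x\<close>
  changes its norm and its distance to \<open>x\<close>.\<close>

lemma shell_inner:
  assumes r: "0 < r" "r \<le> 1/8" and x: "(\<Sum>j<d. (x j)^2) \<le> 1" and y: "y \<in> shell d r x"
  shows "2 * (\<Sum>j<d. y j * x j) \<ge> 1" "2 * (\<Sum>j<d. (y j - x j) * x j) \<ge> - 9 * r^2"
proof -
  define Y X D P where "Y = (\<Sum>j<d. (y j)^2)" and "X = (\<Sum>j<d. (x j)^2)"
    and "D = (\<Sum>j<d. (y j - x j)^2)" and "P = (\<Sum>j<d. y j * x j)"
  have yy: "Y \<le> 1" "D \<le> r^2" "Y > 1 - 8 * r^2" "X \<le> 1"
    using y r x by (auto simp: shell_eq Y_def D_def X_def)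
  have D: "D = Y - 2 * P + X"
    using sum_lincomb_sq[of 1 y "-1" x d] by (simp add: D_def Y_def X_def P_def)
  \<comment> \<open>The squared norm of \<open>y - 2 * x\<close> yields the missing lower bound on
    the norm of \<open>x\<close>, which a priori is only known to be at most 1.\<close>
  have "0 \<le> (\<Sum>j<d. (1 * y j + (-2) * x j)^2)" by (simp add: sum_nonneg)
  then have *: "0 \<le> Y - 4 * P + 4 * X"
    unfolding sum_lincomb_sq by (simp add: Y_def X_def P_def)
  have rr: "r^2 \<le> 1/64" using power_mono[OF r(2), of 2] r by (simp add: power2_eq_square)
  show "2 * (\<Sum>j<d. y j * x j) \<ge> 1" using D * yy rr unfolding P_def[symmetric] by linarith
  have "(\<Sum>j<d. (y j - x j) * x j) = P - X"
    by (simp add: P_def X_def algebra_simps sum_subtractf power2_eq_square)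
  then show "2 * (\<Sum>j<d. (y j - x j) * x j) \<ge> - 9 * r^2" using D yy by linarith
qed

text \<open>The shell has about \<open>1 / (r * sqrt d)\<close> pairwise disjoint translates in direction \<open>- x\<close>
  that a contraction by the factor \<open>d / (d + 1)\<close> towards \<open>x\<close> moves into the neighbourhood of \<open>x\<close>.\<close>

lemma measure_shell_le:
  assumes d: "d \<ge> 1" and r: "0 < r" "9 * r * sqrt (real d) \<le> 1" and x: "x \<in> unit_ball d"
  shows "measure (Rd d) (shell d r x) \<le> 24 * r * sqrt (real d) * measure (Rd d) (nbhd d r x)"
proof -
  have sd: "sqrt (real d) \<ge> 1" using d by simp
  have "r * 1 \<le> r * sqrt (real d)" using r sd by (intro mult_left_mono) auto
  then have r8: "r \<le> 1/8" using r by linarith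
  have x1: "(\<Sum>j<d. (x j)^2) \<le> 1" using x by (simp add: unit_ball_def)
  \<comment> \<open>The translates are \<open>8 * r^2\<close> apart in multiples of
    \<open>x\<close>, matching the thickness of the shell. For \<open>k < K\<close> the total shift
    \<open>s\<close> is at most \<open>r / sqrt d\<close>, so that \<open>s^2 \<le> r^2 / d\<close>,
    which the contraction can absorb.\<close>
  define K where "K = nat \<lceil>1 / (8 * r * sqrt (real d))\<rceil>"
  define a where "a = 1 + 1 / real d"
  have a: "a > 0" "a \<ge> 1" by (auto simp: a_def add_pos_nonneg)
  \<comment> \<open>\<open>T k\<close> is the inverse of translating by \<open>- 8 * r^2 * k\<close>
    times \<open>x\<close> and then contracting by \<open>1 / a\<close> towards \<open>x\<close>;
    hence \<open>F k\<close> is the contracted \<open>k\<close>-th translate of the shell.\<close>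
  define T where "T k = (\<lambda>y. \<lambda>i\<in>{..<d}. a * y i + (1 - a + 8 * r^2 * real k) * x i)" for k :: nat
  have T: "scales (Rd d) ((1 / a) ^ d) (T k)" for k
    unfolding T_def by (rule scales_affine) (use a in auto)
  define F where "F k = T k -` shell d r x \<inter> space (Rd d)" for k
  have Fs: "F k \<in> sets (Rd d)" for k
    unfolding F_def using r by (intro measurable_sets[OF scalesD(1)[OF T]] shell_sets) auto
  have Fm: "measure (Rd d) (F k) = (1 / a) ^ d * measure (Rd d) (shell d r x)" for k
    unfolding F_def using a r by (intro measure_scales[OF T]) auto
  have sub: "F k \<subseteq> nbhd d r x" if "k < K" for k
  proof
    fix z assume z: "z \<in> F k"
    define s where "s = 8 * r^2 * real k"
    have "real k < 1 / (8 * r * sqrt (real d))"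
      using that unfolding K_def by linarith
    then have s: "s \<le> r / sqrt (real d)" "s \<ge> 0"
      using r sd by (auto simp: s_def field_simps power2_eq_square)
    have "r / sqrt (real d) \<le> r / 1" using r sd by (intro divide_left_mono) auto
    then have s1: "s \<le> 1" using s r8 by simp
    define y where "y = T k z"
    have y: "y \<in> shell d r x" using z by (simp add: F_def y_def)
    have y1: "(\<Sum>j<d. (y j)^2) \<le> 1" "(\<Sum>j<d. (y j - x j)^2) \<le> r^2" using y r by (auto simp: shell_eq)
    note inn = shell_inner[OF r(1) r8 x1 y]
    define v where "v j = 1 * y j + (- s) * x j" for j
    have zv: "z j = (1 - 1/a) * x j + (1/a) * v j" if "j < d" for j
      using that a by (simp add: y_def T_def v_def s_def field_simps)
    \<comment> \<open>The translate stays in the ball: as \<open>2 * (y \<cdot> x) \<ge> 1\<close>,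
      the shift lowers the squared norm by at least \<open>s\<close> up to the error
      \<open>s^2 \<le> s\<close>.\<close>
    have "(\<Sum>j<d. (v j)^2) \<le> 1 + (- s) + s^2"
    proof -
      have "s^2 * (\<Sum>j<d. (x j)^2) \<le> s^2 * 1" using x1 by (intro mult_left_mono) auto
      moreover have "s * 1 \<le> s * (2 * (\<Sum>j<d. y j * x j))" using s inn by (intro mult_left_mono) auto
      ultimately show ?thesis unfolding v_def sum_lincomb_sq using y1 by (simp add: algebra_simps)
    qed
    also have "\<dots> \<le> 1" using s s1 by (simp add: power2_eq_square mult_left_le)
    finally have v1: "(\<Sum>j<d. (v j)^2) \<le> 1" .
    have "(\<Sum>j<d. (z j)^2) \<le> 1"
      using sum_convex_sq[OF _ _ x1 v1, of "1/a"] a zv by simp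
    moreover have "(\<Sum>j<d. (z j - x j)^2) \<le> r^2"
    proof -
      have "(\<Sum>j<d. (z j - x j)^2) = (\<Sum>j<d. (1/a)^2 * (1 * (y j - x j) + (- s) * x j)^2)"
        by (rule sum.cong) (auto simp: zv v_def power2_eq_square algebra_simps)
      also have "\<dots> = (1/a)^2 * (\<Sum>j<d. (1 * (y j - x j) + (- s) * x j)^2)"
        by (simp only: sum_distrib_left)
      finally have scaled: "(\<Sum>j<d. (z j - x j)^2) = (1/a)^2 * (\<Sum>j<d. (1 * (y j - x j) + (- s) * x j)^2)" .
      have "(\<Sum>j<d. (1 * (y j - x j) + (- s) * x j)^2) \<le> r^2 + s * (9 * r^2) + s^2"
      proof -
        have "s^2 * (\<Sum>j<d. (x j)^2) \<le> s^2 * 1" using x1 by (intro mult_left_mono) auto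
        moreover have "s * (- 9 * r^2) \<le> s * (2 * (\<Sum>j<d. (y j - x j) * x j))"
          using s inn by (intro mult_left_mono) auto
        ultimately show ?thesis unfolding sum_lincomb_sq using y1 by (simp add: algebra_simps)
      qed
      \<comment> \<open>The shift enlarges the squared distance to \<open>x\<close> by a factor of
        at most \<open>1 + 2/d \<le> a^2\<close>, which the contraction compensates. The hypothesis
        \<open>9 * r * sqrt d \<le> 1\<close> bounds the term linear in \<open>s\<close>.\<close>
      also have "\<dots> \<le> r^2 + r^2 / real d + r^2 / real d"
      proof -
        have "s^2 \<le> (r / sqrt (real d))^2" using s by (intro power_mono) auto
        then have "s^2 \<le> r^2 / real d" by (simp add: power_divide)
        moreover have "s * (9 * r^2) \<le> r^2 / real d"
        proof -
          have "s * (9 * r^2) \<le> (r / sqrt (real d)) * (9 * r^2)"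
            using s by (intro mult_right_mono) auto
          also have "\<dots> = (r^2 / real d) * (9 * r * sqrt (real d))"
            using d by (simp add: field_simps power2_eq_square)
          also have "\<dots> \<le> (r^2 / real d) * 1"
            using r by (intro mult_left_mono) auto
          finally show ?thesis by simp
        qed
        ultimately show ?thesis by simp
      qed
      also have "\<dots> \<le> a^2 * r^2"
        by (simp add: a_def power2_eq_square algebra_simps)
      finally have "(1/a)^2 * (\<Sum>j<d. (1 * (y j - x j) + (- s) * x j)^2) \<le> (1/a)^2 * (a^2 * r^2)"
        by (rule mult_left_mono) simp
      also have "\<dots> = r^2" using a by (simp add: power_divide)
      finally show ?thesis using scaled by simp
    qed
    moreover have "z \<in> space (Rd d)" using z by (simp add: F_def)
    ultimately show "z \<in> nbhd d r x" unfolding nbhd_eq[OF less_imp_le[OF r(1)]] by blast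
  qed
  \<comment> \<open>A common point would give two points of the shell that differ by
    \<open>\<tau>\<close> times \<open>x\<close> with \<open>\<tau> \<ge> 8 * r^2\<close>. Their
    squared norms then differ by at least \<open>\<tau>\<close>, more than the shell allows.\<close>
  have "F k \<inter> F l = {}" if "k < l" for k l
  proof (rule ccontr)
    assume "F k \<inter> F l \<noteq> {}"
    then obtain z where z: "z \<in> F k" "z \<in> F l" by auto
    define y \<tau> where "y = T k z" and "\<tau> = 8 * r^2 * (real l - real k)"
    have y: "y \<in> shell d r x" and y': "T l z \<in> shell d r x" using z by (auto simp: F_def y_def)
    have "8 * r^2 * 1 \<le> \<tau>" unfolding \<tau>_def using that r by (intro mult_left_mono) auto
    then have \<tau>: "8 * r^2 \<le> \<tau>" "\<tau> \<ge> 0" using that by (auto simp: \<tau>_def)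
    have "T l z j = 1 * y j + \<tau> * x j" if "j < d" for j
      using that by (simp add: y_def T_def \<tau>_def algebra_simps)
    then have "(\<Sum>j<d. (T l z j)^2) = (\<Sum>j<d. (1 * y j + \<tau> * x j)^2)" by simp
    also have "\<dots> = (\<Sum>j<d. (y j)^2) + \<tau> * (2 * (\<Sum>j<d. y j * x j)) + \<tau>^2 * (\<Sum>j<d. (x j)^2)"
      unfolding sum_lincomb_sq by simp
    also have "\<dots> \<ge> (\<Sum>j<d. (y j)^2) + \<tau> * 1 + 0"
      using shell_inner[OF r(1) r8 x1 y] \<tau> by (intro add_mono mult_left_mono mult_nonneg_nonneg sum_nonneg) auto
    finally have "(\<Sum>j<d. (y j)^2) + \<tau> \<le> (\<Sum>j<d. (T l z j)^2)" by simp
    moreover have "(\<Sum>j<d. (T l z j)^2) \<le> 1" "1 - 8 * r^2 < (\<Sum>j<d. (y j)^2)"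
      using y y' unfolding shell_eq[OF less_imp_le[OF r(1)]] by blast+
    ultimately show False using \<tau> by linarith
  qed
  then have "disjoint_family_on F {..<K}"
    unfolding disjoint_family_on_def by (metis Int_commute linorder_neqE_nat)
  then have "measure (Rd d) (\<Union>k<K. F k) = (\<Sum>k<K. measure (Rd d) (F k))"
  proof (intro measure_finite_Union)
    show "F ` {..<K} \<subseteq> sets (Rd d)" using Fs by blast
    fix k assume "k \<in> {..<K}"
    then have "F k \<subseteq> unit_ball d" using sub[of k] by (auto simp: nbhd_def)
    from fmeasurable_unit_ball_subset[OF d Fs this] show "emeasure (Rd d) (F k) \<noteq> \<infinity>"
      by (simp add: fmeasurableD2)
  qed auto
  also have "\<dots> = real K * ((1 / a) ^ d * measure (Rd d) (shell d r x))"
    by (simp add: Fm)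
  finally have "real K * ((1 / a) ^ d * measure (Rd d) (shell d r x)) = measure (Rd d) (\<Union>k<K. F k)" ..
  also have "\<dots> \<le> measure (Rd d) (nbhd d r x)"
  proof (rule measure_mono_fmeasurable)
    show "(\<Union>k<K. F k) \<subseteq> nbhd d r x" using sub by blast
    show "(\<Union>k<K. F k) \<in> sets (Rd d)" using Fs by blast
    show "nbhd d r x \<in> fmeasurable (Rd d)"
      by (intro fmeasurable_unit_ball_subset d nbhd_sets) (use r in \<open>auto simp: nbhd_def\<close>)
  qed
  finally have 1: "real K * ((1 / a) ^ d * measure (Rd d) (shell d r x)) \<le> measure (Rd d) (nbhd d r x)" .
  \<comment> \<open>The contraction costs a factor of at most \<open>exp 1 \<le> 3\<close> in
    volume. With \<open>K \<ge> 1 / (8 * r * sqrt d)\<close> disjoint copies this gives the constant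
    \<open>24 = 3 * 8\<close>.\<close>
  have "a ^ d \<le> exp (1 / real d) ^ d"
    unfolding a_def by (intro power_mono exp_ge_add_one_self) auto
  also have "\<dots> = exp 1" using d by (simp add: exp_of_nat_mult[symmetric])
  also have "\<dots> \<le> 3" by (rule exp_le)
  finally have "(1 / a) ^ d \<ge> 1 / 3" using a by (simp add: power_one_over field_simps)
  moreover have "real K \<ge> 1 / (8 * r * sqrt (real d))"
    unfolding K_def by linarith
  ultimately have "1 / (8 * r * sqrt (real d)) * (1/3 * measure (Rd d) (shell d r x))
      \<le> real K * ((1 / a) ^ d * measure (Rd d) (shell d r x))"
    using a r by (intro mult_mono) auto
  with 1 have "1 / (8 * r * sqrt (real d)) * (1/3 * measure (Rd d) (shell d r x)) \<le> measure (Rd d) (nbhd d r x)"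
    by simp
  then show ?thesis using r sd by (simp add: field_simps)
qed

text \<open>Outside the shell, the volume-preserving reflection carries the near half
  \<open>?L\<close> of the neighbourhood into the far half \<open>?U\<close>, all of which is
  farther than \<open>r\<close> from the separator. Hence \<open>?L\<close> exceeds
  \<open>?U\<close> in volume by at most the shell.\<close>

lemma measure_far_half_aux:
  assumes d: "d \<ge> 1" and r: "0 < r" and w: "(\<Sum>j<d. (w j)^2) = 1"
    and wx: "r < dotp d w x" "dotp d w x \<le> 2 * r"
  shows "measure (Rd d) (nbhd d r x)
    \<le> 2 * measure (Rd d) {y \<in> nbhd d r x. \<bar>dotp d w y\<bar> > r} + measure (Rd d) (shell d r x)"
proof -
  define c where "c = dotp d w x"
  let ?R = "refl_map d w c"
  let ?L = "{y \<in> nbhd d r x. dotp d w y < c}" and ?U = "{y \<in> nbhd d r x. dotp d w y \<ge> c}"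
  have sc: "scales (Rd d) 1 ?R" by (rule scales_reflection[OF w])
  have r0: "r \<ge> 0" using r by simp
  have Ls: "?L \<in> sets (Rd d)" and Us: "?U \<in> sets (Rd d)"
    unfolding nbhd_eq[OF r0] by measurable
  have As: "{y \<in> nbhd d r x. \<bar>dotp d w y\<bar> > r} \<in> sets (Rd d)"
    unfolding nbhd_eq[OF r0] by measurable
  have Ru: "?R -` ?U \<inter> space (Rd d) \<in> sets (Rd d)"
    by (rule measurable_sets[OF scalesD(1)[OF sc] Us])
  note fm = fmeasurable_unit_ball_subset[OF d]
  have Lfm: "?L \<in> fmeasurable (Rd d)" and Ufm: "?U \<in> fmeasurable (Rd d)"
    and Sfm: "shell d r x \<in> fmeasurable (Rd d)"
    by (rule fm[OF Ls], force simp: nbhd_def, rule fm[OF Us], force simp: nbhd_def,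
        rule fm[OF shell_sets[OF r0]], force simp: nbhd_def shell_def)
  have Afm: "{y \<in> nbhd d r x. \<bar>dotp d w y\<bar> > r} \<in> fmeasurable (Rd d)"
    by (rule fm[OF As]) (auto simp: nbhd_def)
  have "emeasure (Rd d) (?R -` ?U \<inter> space (Rd d)) < \<infinity>"
    using scales_emeasure[OF sc Us] fmeasurableD2[OF Ufm] by (simp add: top.not_eq_extremum)
  then have RUfm: "?R -` ?U \<inter> space (Rd d) \<in> fmeasurable (Rd d)"
    using Ru by (intro fmeasurableI) auto
  have "?L \<subseteq> (?R -` ?U \<inter> space (Rd d)) \<union> shell d r x"
  proof
    fix y assume y: "y \<in> ?L"
    have ysp: "y \<in> space (Rd d)" using y r by (auto simp: nbhd_eq)
    have yy: "(\<Sum>j<d. (y j)^2) \<le> 1" "(\<Sum>j<d. (y j - x j)^2) \<le> r^2"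
      using y r by (auto simp: nbhd_eq)
    define b where "b = dotp d w y - c"
    have b0: "b < 0" using y by (simp add: b_def)
    have "\<bar>b\<bar> \<le> r" unfolding b_def c_def
      by (rule dotp_diff_le_distd[OF w]) (use y r in \<open>auto simp: nbhd_def\<close>)
    then have b: "- b \<le> r" by simp
    have bd: "(\<Sum>j<d. (y j - x j) * w j) = b"
      by (simp add: b_def c_def dotp_def sum_subtractf[symmetric] algebra_simps)
    have Rj: "?R y j = y j - 2 * b * w j" if "j < d" for j
      using that by (simp add: refl_map_def b_def)
    \<comment> \<open>With \<open>b < 0\<close> the signed distance of \<open>y\<close> to the
      mirror, the reflection adds \<open>4 * (- b) * c\<close> to the squared norm, keeps the
      distance to \<open>x\<close> and changes the sign of \<open>b\<close>.\<close>
    have n1: "(\<Sum>j<d. (?R y j)^2) = (\<Sum>j<d. (y j)^2) + 4 * (- b) * c"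
    proof -
      have "(\<Sum>j<d. (?R y j)^2) = (\<Sum>j<d. (1 * y j + (- 2 * b) * w j)^2)"
        by (rule sum.cong) (auto simp: Rj)
      also have "\<dots> = (\<Sum>j<d. (y j)^2) + 2 * (- 2 * b) * dotp d w y + 4 * b^2"
        unfolding sum_lincomb_sq w by (simp add: dotp_def mult.commute)
      also have "dotp d w y = b + c" by (simp add: b_def)
      finally show ?thesis by (simp add: power2_eq_square algebra_simps)
    qed
    have n2: "(\<Sum>j<d. (?R y j - x j)^2) = (\<Sum>j<d. (y j - x j)^2)"
    proof -
      have "(\<Sum>j<d. (?R y j - x j)^2) = (\<Sum>j<d. (1 * (y j - x j) + (- 2 * b) * w j)^2)"
        by (rule sum.cong) (auto simp: Rj algebra_simps)
      also have "\<dots> = (\<Sum>j<d. (y j - x j)^2)"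
        unfolding sum_lincomb_sq w bd by (simp add: power2_eq_square)
      finally show ?thesis .
    qed
    have n3: "dotp d w (?R y) = c - b"
    proof -
      have "dotp d w (?R y) = (\<Sum>j<d. w j * y j - 2 * b * (w j)^2)"
        unfolding dotp_def by (rule sum.cong) (auto simp: Rj power2_eq_square algebra_simps)
      also have "\<dots> = dotp d w y - 2 * b"
        by (simp add: sum_subtractf dotp_def w sum_distrib_left[symmetric])
      finally show ?thesis by (simp add: b_def)
    qed
    have "(- b) * c \<le> r * (2 * r)"
      using b b0 wx r by (intro mult_mono) (auto simp: c_def)
    then have "(\<Sum>j<d. (?R y j)^2) \<le> (\<Sum>j<d. (y j)^2) + 8 * r^2"
      unfolding n1 by (simp add: power2_eq_square)
    moreover have "?R y \<in> space (Rd d)"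
      using measurable_space[OF scalesD(1)[OF sc] ysp] .
    ultimately show "y \<in> (?R -` ?U \<inter> space (Rd d)) \<union> shell d r x"
      using ysp yy r b0 n2 n3 by (auto simp: nbhd_eq shell_eq)
  qed
  then have "measure (Rd d) ?L \<le> measure (Rd d) ((?R -` ?U \<inter> space (Rd d)) \<union> shell d r x)"
    using Lfm RUfm Sfm by (intro measure_mono_fmeasurable fmeasurable.Un) auto
  also have "\<dots> \<le> measure (Rd d) (?R -` ?U \<inter> space (Rd d)) + measure (Rd d) (shell d r x)"
    using RUfm Sfm by (intro measure_Un_le) auto
  also have "measure (Rd d) (?R -` ?U \<inter> space (Rd d)) = measure (Rd d) ?U"
    using measure_scales[OF sc Us] by simp
  finally have "measure (Rd d) ?L \<le> measure (Rd d) ?U + measure (Rd d) (shell d r x)" .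
  moreover have "measure (Rd d) ?U \<le> measure (Rd d) {y \<in> nbhd d r x. \<bar>dotp d w y\<bar> > r}"
    by (rule measure_mono_fmeasurable[OF _ Us Afm]) (use wx in \<open>auto simp: c_def\<close>)
  moreover have "measure (Rd d) (nbhd d r x) \<le> measure (Rd d) ?L + measure (Rd d) ?U"
  proof -
    have "nbhd d r x = ?L \<union> ?U" by auto
    then show ?thesis using measure_Un_le[OF Ls Us] by simp
  qed
  ultimately show ?thesis by simp
qed

text \<open>Beyond \<open>2 * r\<close> the whole neighbourhood is far. Otherwise the reflection
  argument applies, to \<open>- w\<close> if \<open>x\<close> is on the negative side.\<close>

lemma measure_far_half:
  assumes d: "d \<ge> 1" and r: "0 < r" "144 * r * sqrt (real d) \<le> \<gamma>" "\<gamma> \<le> 1/2"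
    and w: "(\<Sum>j<d. (w j)^2) = 1" and x: "x \<in> unit_ball d" and wx: "r < \<bar>dotp d w x\<bar>"
  shows "measure (Rd d) {y \<in> nbhd d r x. \<bar>dotp d w y\<bar> > r} \<ge> (1/2 - \<gamma>/12) * measure (Rd d) (nbhd d r x)"
proof (cases "\<bar>dotp d w x\<bar> > 2 * r")
  case True
  have "{y \<in> nbhd d r x. \<bar>dotp d w y\<bar> > r} = nbhd d r x"
    using dotp_diff_le_distd[OF w, of r x] True r by (force simp: nbhd_def)
  moreover have "0 < r * sqrt (real d)" using d r by simp
  then have "\<gamma> > 0" using r by linarith
  then have "(1/2 - \<gamma>/12) * measure (Rd d) (nbhd d r x) \<le> 1 * measure (Rd d) (nbhd d r x)"
    by (intro mult_right_mono) auto
  ultimately show ?thesis by simp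
next
  case False
  have neg: "dotp d (\<lambda>j. - w j) y = - dotp d w y" for y
    by (simp add: dotp_def sum_negf)
  have "measure (Rd d) (nbhd d r x)
    \<le> 2 * measure (Rd d) {y \<in> nbhd d r x. \<bar>dotp d w y\<bar> > r} + measure (Rd d) (shell d r x)"
  proof (cases "dotp d w x > 0")
    case True
    then show ?thesis using False wx by (intro measure_far_half_aux[OF d r(1) w]) auto
  next
    case neg': False
    then show ?thesis
      using measure_far_half_aux[OF d r(1), of "\<lambda>j. - w j" x] False wx w by (simp add: neg)
  qed
  moreover have "measure (Rd d) (shell d r x) \<le> 24 * r * sqrt (real d) * measure (Rd d) (nbhd d r x)"
    by (rule measure_shell_le[OF d r(1) _ x]) (use r in linarith)
  \<comment> \<open>Origin of the constant \<open>144 = 6 * 24\<close>: the shell takes up at most a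
    fraction \<open>\<gamma>/6\<close> of the neighbourhood, and half of that is lost.\<close>
  moreover have "24 * r * sqrt (real d) * measure (Rd d) (nbhd d r x) \<le> \<gamma> / 6 * measure (Rd d) (nbhd d r x)"
    using r by (intro mult_right_mono) auto
  ultimately show ?thesis by (simp add: algebra_simps)
qed

section \<open>Best-response dynamics\<close>

text \<open>A permutation lets sensor \<open>prm l\<close> act only in the transition from
  \<open>l\<close> to \<open>Suc l\<close>; up to time \<open>l\<close> it keeps its initial
  state.\<close>

lemma brd_run_before:
  assumes "prm permutes {..<N}" "k \<le> l"
  shows "brd_run d r N X prm tb s0 k (prm l) = s0 (prm l)"
  using assms(2)
proof (induction k)
  case (Suc k)
  then have "prm l \<noteq> prm k"
    using permutes_inj[OF assms(1)] by (metis Suc_n_not_le_n inj_eq)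
  then show ?case using Suc by (simp add: Let_def)
qed simp

lemma brd_run_after:
  assumes "prm permutes {..<N}" "l < k"
  shows "brd_run d r N X prm tb s0 k (prm l) = brd_run d r N X prm tb s0 (Suc l) (prm l)"
  using assms(2)
proof (induction k)
  case (Suc k)
  show ?case
  proof (cases "l = k")
    case False
    then have "prm l \<noteq> prm k"
      using permutes_inj[OF assms(1)] by (metis inj_eq)
    then show ?thesis using Suc False by (simp add: Let_def)
  qed simp
qed simp

lemma target_neighbor:
  assumes "(\<Sum>j<d. (w j)^2) = 1" "r \<ge> 0" "\<bar>dotp d w (X i)\<bar> > r" "j \<in> neighbors d r N X i"
  shows "target d w (X j) = target d w (X i)"
  using dotp_diff_le_distd[OF assms(1,2), of "X i" "X j"] assms(3,4)
  unfolding target_def neighbors_def by auto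

lemma best_response_majority:
  fixes t :: bool
  assumes "(\<Sum>j\<in>neighbors d r N X i. if s j = t then 1 else -1 :: real) > 0"
  shows "best_response d r N X s i tie = t"
proof -
  let ?B = "neighbors d r N X i"
  have fin: "finite ?B" by (simp add: neighbors_def)
  have "(\<Sum>j\<in>?B. if s j = t then 1 else -1 :: real)
      = real (card {j \<in> ?B. s j = t}) - real (card {j \<in> ?B. s j \<noteq> t})"
    using fin by (simp add: sum.If_cases Int_def Collect_neg_eq[symmetric])
  then have "card {j \<in> ?B. s j = t} > card {j \<in> ?B. s j \<noteq> t}"
    using assms by simp
  then show ?thesis by (cases t) (auto simp: best_response_def Let_def)
qed

text \<open>A lower bound for the number of neighbours on the correct side minus the number on
  the wrong side: sensors of \<open>E\<close> have updated, and are trusted if they are at distance more than \<open>r\<close>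
  from the separator; those of \<open>F\<close> still have their initial state; the remaining ones may be adversarial.\<close>

definition vote :: "nat \<Rightarrow> real \<Rightarrow> (nat \<Rightarrow> real) \<Rightarrow> nat set \<Rightarrow> nat set \<Rightarrow> nat \<Rightarrow> (nat \<Rightarrow> real) \<Rightarrow> bool \<Rightarrow> real" where
  "vote d r w E F j y b =
     (if j \<in> E then (if \<bar>dotp d w y\<bar> > r then 1 else -1)
      else if j \<in> F then (if b = target d w y then 1 else -1) else -1)"

definition margin :: "nat \<Rightarrow> real \<Rightarrow> (nat \<Rightarrow> real) \<Rightarrow> nat \<Rightarrow> nat set \<Rightarrow> nat set \<Rightarrow> nat
    \<Rightarrow> (nat \<Rightarrow> nat \<Rightarrow> real) \<Rightarrow> (nat \<Rightarrow> bool) \<Rightarrow> real" where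
  "margin d r w N E F i X s0 = (\<Sum>j\<in>neighbors d r N X i. vote d r w E F j (X j) (s0 j))"

text \<open>Neighbours share the target of \<open>prm k\<close>, so each \<open>vote\<close> is at
  most the true contribution of that neighbour: states in \<open>E\<close> are frozen since their
  own update, states in \<open>F\<close> are still initial, and -1 is the worst case for the
  rest.\<close>

lemma update_correct:
  assumes w: "(\<Sum>j<d. (w j)^2) = 1" and r: "r \<ge> 0" and prm: "prm permutes {..<N}"
    and far: "\<bar>dotp d w (X (prm k))\<bar> > r"
    and margin: "margin d r w N E F (prm k) X s0 > 0"
    and E: "\<And>j. j \<in> E \<Longrightarrow> \<exists>l<k. j = prm l \<and> (\<bar>dotp d w (X j)\<bar> > r \<longrightarrow>
        brd_run d r N X prm tb s0 (Suc l) j = target d w (X j))"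
    and F: "\<And>j. j \<in> F \<Longrightarrow> \<exists>l\<ge>k. j = prm l"
  shows "brd_run d r N X prm tb s0 (Suc k) (prm k) = target d w (X (prm k))"
proof -
  let ?s = "brd_run d r N X prm tb s0 k"
  have "vote d r w E F j (X j) (s0 j) \<le> (if ?s j = target d w (X (prm k)) then 1 else -1)"
    if j: "j \<in> neighbors d r N X (prm k)" for j
  proof -
    note t = target_neighbor[OF w r far j]
    consider "j \<in> E" | "j \<notin> E" "j \<in> F" | "j \<notin> E" "j \<notin> F" by blast
    then show ?thesis
    proof cases
      case 1
      from E[OF 1] obtain l where l: "l < k" "j = prm l"
        "\<bar>dotp d w (X j)\<bar> > r \<longrightarrow> brd_run d r N X prm tb s0 (Suc l) j = target d w (X j)"
        by blast
      then have "\<bar>dotp d w (X j)\<bar> > r \<longrightarrow> ?s j = target d w (X j)"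
        using brd_run_after[OF prm l(1)] by metis
      then show ?thesis using 1 t by (auto simp: vote_def)
    next
      case 2
      then have "?s j = s0 j" using F[OF 2(2)] brd_run_before[OF prm] by metis
      then show ?thesis using 2 t by (auto simp: vote_def)
    qed (simp add: vote_def)
  qed
  then have "margin d r w N E F (prm k) X s0
      \<le> (\<Sum>j\<in>neighbors d r N X (prm k). if ?s j = target d w (X (prm k)) then 1 else -1)"
    unfolding margin_def by (rule sum_mono)
  with margin have "0 < (\<Sum>j\<in>neighbors d r N X (prm k). if ?s j = target d w (X (prm k)) then 1 else -1 :: real)"
    by linarith
  from best_response_majority[OF this] show ?thesis by (simp add: Let_def)
qed

text \<open>All randomness is confined to the margins; this implication holds for every outcome and
  every tie-breaking rule.\<close>

lemma good_event_if_margins: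
  assumes w: "(\<Sum>j<d. (w j)^2) = 1" and r: "r \<ge> 0" and prm: "prm permutes {..<N}" and m: "m \<le> N"
    and early: "\<And>k. k < m \<Longrightarrow> \<bar>dotp d w (X (prm k))\<bar> > r
      \<Longrightarrow> margin d r w N (prm ` {..<k}) (prm ` {k<..<N}) (prm k) X s0 > 0"
    and late: "\<And>k. m \<le> k \<Longrightarrow> k < N \<Longrightarrow> \<bar>dotp d w (X (prm k))\<bar> > 2 * r
      \<Longrightarrow> margin d r w N (prm ` {..<m}) {} (prm k) X s0 > 0"
  shows "good_event d r w N X prm tb s0"
proof -
  \<comment> \<open>The induction covers all sensors beyond \<open>r\<close>, not merely
    \<open>2 * r\<close>, because later margins trust every updated sensor beyond
    \<open>r\<close>.\<close>
  have A: "brd_run d r N X prm tb s0 (Suc k) (prm k) = target d w (X (prm k))"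
    if "k < m" "\<bar>dotp d w (X (prm k))\<bar> > r" for k
    using that
  proof (induction k rule: less_induct)
    case (less k)
    show ?case
    proof (rule update_correct[OF w r prm less.prems(2) early[OF less.prems]])
      fix j assume "j \<in> prm ` {..<k}"
      then obtain l where "l < k" "j = prm l" by auto
      then show "\<exists>l<k. j = prm l \<and> (\<bar>dotp d w (X j)\<bar> > r \<longrightarrow>
        brd_run d r N X prm tb s0 (Suc l) j = target d w (X j))"
        using less.IH[of l] less.prems(1) by auto
    next
      fix j assume "j \<in> prm ` {k<..<N}"
      then obtain l where "k < l" "j = prm l" by auto
      then show "\<exists>l\<ge>k. j = prm l" by (intro exI[of _ l]) auto
    qed
  qed
  show ?thesis
    unfolding good_event_def
  proof (intro allI impI)
    fix k assume k: "k < N" "\<bar>dotp d w (X (prm k))\<bar> > 2 * r"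
    then have far: "\<bar>dotp d w (X (prm k))\<bar> > r" using r by linarith
    show "brd_run d r N X prm tb s0 (Suc k) (prm k) = target d w (X (prm k))"
    proof (cases "k < m")
      case True
      then show ?thesis by (rule A[OF _ far])
    next
      case False
      then have "m \<le> k" by simp
      show ?thesis
      proof (rule update_correct[OF w r prm far late[OF \<open>m \<le> k\<close> k]])
        fix j assume "j \<in> prm ` {..<m}"
        then obtain l where "l < m" "j = prm l" by auto
        then show "\<exists>l<k. j = prm l \<and> (\<bar>dotp d w (X j)\<bar> > r \<longrightarrow>
          brd_run d r N X prm tb s0 (Suc l) j = target d w (X j))"
          using A[of l] \<open>m \<le> k\<close> by (intro exI[of _ l]) auto
      qed simp
    qed
  qed
qed

section \<open>Tail bounds for the margin of a sensor\<close>

text \<open>Independence of the initial states: the expectation of a product of functions of the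
  single states is the product of the expectations.\<close>

lemma sum_state_prob_prod:
  "(\<Sum>s0\<in>{..<N} \<rightarrow>\<^sub>E (UNIV :: bool set). state_prob d w N X q s0 * (\<Prod>j<N. f j (s0 j)))
    = (\<Prod>j<N. q j * f j (target d w (X j)) + (1 - q j) * f j (\<not> target d w (X j)))"
proof -
  have "(\<Sum>s0\<in>{..<N} \<rightarrow>\<^sub>E (UNIV :: bool set). state_prob d w N X q s0 * (\<Prod>j<N. f j (s0 j)))
      = (\<Sum>s0\<in>{..<N} \<rightarrow>\<^sub>E (UNIV :: bool set). \<Prod>j<N. (if s0 j = target d w (X j) then q j else 1 - q j) * f j (s0 j))"
    by (simp add: state_prob_def prod.distrib)
  also have "\<dots> = (\<Prod>j<N. \<Sum>b\<in>UNIV. (if b = target d w (X j) then q j else 1 - q j) * f j b)"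
    by (rule prod_sum_PiE[symmetric]) auto
  also have "\<dots> = (\<Prod>j<N. q j * f j (target d w (X j)) + (1 - q j) * f j (\<not> target d w (X j)))"
    by (rule prod.cong) (auto simp: UNIV_bool)
  finally show ?thesis .
qed

lemma sum_state_prob: "(\<Sum>s0\<in>{..<N} \<rightarrow>\<^sub>E (UNIV :: bool set). state_prob d w N X q s0) = 1"
  using sum_state_prob_prod[where f = "\<lambda>_ _. 1"] by simp

lemma state_prob_nonneg:
  assumes "\<And>i. i < N \<Longrightarrow> 0 \<le> q i \<and> q i \<le> 1"
  shows "state_prob d w N X q s0 \<ge> 0"
  unfolding state_prob_def by (rule prod_nonneg) (use assms in auto)

text \<open>For \<open>z \<ge> 0\<close>, an upper bound on the mean of
  \<open>exp (- z * vote)\<close> over the initial state of a neighbour at \<open>y\<close>, taken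
  at the maximal noise rate; a sensor out of range contributes the factor 1.\<close>

definition weight :: "nat \<Rightarrow> real \<Rightarrow> (nat \<Rightarrow> real) \<Rightarrow> real \<Rightarrow> real \<Rightarrow> nat set \<Rightarrow> nat set \<Rightarrow> nat
    \<Rightarrow> (nat \<Rightarrow> real) \<Rightarrow> (nat \<Rightarrow> real) \<Rightarrow> real" where
  "weight d r w z \<eta> E F j x y =
     (if distd d x y \<le> r then
        (if j \<in> E then (if \<bar>dotp d w y\<bar> > r then exp (- z) else exp z)
         else if j \<in> F then (1 - \<eta>) * exp (- z) + \<eta> * exp z else exp z)
      else 1)"

definition tail_bound :: "nat \<Rightarrow> real \<Rightarrow> (nat \<Rightarrow> real) \<Rightarrow> real \<Rightarrow> real \<Rightarrow> nat \<Rightarrow> nat set \<Rightarrow> nat set \<Rightarrow> real \<Rightarrow> nat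
    \<Rightarrow> (nat \<Rightarrow> nat \<Rightarrow> real) \<Rightarrow> real" where
  "tail_bound d r w z \<eta> N E F \<rho> i X =
     (if \<bar>dotp d w (X i)\<bar> > \<rho> then (\<Prod>j\<in>{..<N} - {i}. weight d r w z \<eta> E F j (X i) (X j)) else 0)"

lemma weight_nonneg: "0 \<le> \<eta> \<Longrightarrow> \<eta> \<le> 1 \<Longrightarrow> weight d r w z \<eta> E F j x y \<ge> 0"
  by (simp add: weight_def)

lemma tail_bound_nonneg: "0 \<le> \<eta> \<Longrightarrow> \<eta> \<le> 1 \<Longrightarrow> tail_bound d r w z \<eta> N E F \<rho> i X \<ge> 0"
  by (simp add: tail_bound_def prod_nonneg weight_nonneg)

text \<open>The exponential Markov inequality, for fixed positions.\<close>

lemma prob_margin_le: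
  assumes q: "\<And>j. j < N \<Longrightarrow> 1 - \<eta> \<le> q j \<and> q j \<le> 1" and \<eta>: "0 \<le> \<eta>" "\<eta> \<le> 1" and z: "z \<ge> 0" and i: "i < N"
  shows "(\<Sum>s0\<in>{..<N} \<rightarrow>\<^sub>E (UNIV :: bool set). state_prob d w N X q s0 *
      of_bool (\<bar>dotp d w (X i)\<bar> > \<rho> \<and> margin d r w N E F i X s0 \<le> 0)) \<le> tail_bound d r w z \<eta> N E F \<rho> i X"
proof (cases "\<bar>dotp d w (X i)\<bar> > \<rho>")
  case True
  let ?nb = "neighbors d r N X i"
  define f where "f j b = (if j \<in> ?nb then exp (- z * vote d r w E F j (X j) b) else 1)" for j b
  define t where "t j = target d w (X j)" for j
  have nb: "?nb \<subseteq> {..<N}" by (auto simp: neighbors_def)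
  have sp: "state_prob d w N X q s0 \<ge> 0" for s0
    by (rule state_prob_nonneg) (use q \<eta> in force)
  have "(\<Sum>s0\<in>{..<N} \<rightarrow>\<^sub>E (UNIV :: bool set). state_prob d w N X q s0 *
      of_bool (\<bar>dotp d w (X i)\<bar> > \<rho> \<and> margin d r w N E F i X s0 \<le> 0))
    \<le> (\<Sum>s0\<in>{..<N} \<rightarrow>\<^sub>E (UNIV :: bool set). state_prob d w N X q s0 * (\<Prod>j<N. f j (s0 j)))"
  proof (intro sum_mono mult_left_mono sp)
    fix s0 :: "nat \<Rightarrow> bool"
    have "(\<Prod>j<N. f j (s0 j)) = (\<Prod>j\<in>?nb. exp (- z * vote d r w E F j (X j) (s0 j)))"
      unfolding f_def using nb by (subst prod.inter_restrict[symmetric]) (auto simp: Int_absorb1)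
    also have "\<dots> = exp (- z * margin d r w N E F i X s0)"
      using finite_subset[OF nb] by (simp add: margin_def sum_distrib_left exp_sum)
    finally have eq: "(\<Prod>j<N. f j (s0 j)) = exp (- z * margin d r w N E F i X s0)" .
    show "of_bool (\<bar>dotp d w (X i)\<bar> > \<rho> \<and> margin d r w N E F i X s0 \<le> 0) \<le> (\<Prod>j<N. f j (s0 j))"
      unfolding eq using z by (auto simp: mult_nonneg_nonpos)
  qed
  also have "\<dots> = (\<Prod>j<N. q j * f j (t j) + (1 - q j) * f j (\<not> t j))"
    unfolding t_def by (rule sum_state_prob_prod)
  also have "\<dots> = (q i * f i (t i) + (1 - q i) * f i (\<not> t i))
      * (\<Prod>j\<in>{..<N} - {i}. q j * f j (t j) + (1 - q j) * f j (\<not> t j))"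
    using i by (simp add: prod.remove[of "{..<N}" i])
  also have "q i * f i (t i) + (1 - q i) * f i (\<not> t i) = 1"
    by (simp add: f_def neighbors_def)
  also have "1 * (\<Prod>j\<in>{..<N} - {i}. q j * f j (t j) + (1 - q j) * f j (\<not> t j))
      \<le> (\<Prod>j\<in>{..<N} - {i}. weight d r w z \<eta> E F j (X i) (X j))"
    unfolding mult_1
  proof (intro prod_mono conjI)
    fix j assume j: "j \<in> {..<N} - {i}"
    have qj: "1 - \<eta> \<le> q j" "q j \<le> 1" using q j by auto
    have fp: "f j b \<ge> 0" for b by (simp add: f_def)
    show "0 \<le> q j * f j (t j) + (1 - q j) * f j (\<not> t j)"
      using qj \<eta> fp by (intro add_nonneg_nonneg mult_nonneg_nonneg) auto
    \<comment> \<open>Less noise only lowers the mean, because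
      \<open>exp (- z) \<le> exp z\<close>.\<close>
    have mix: "q j * exp (- z) + (1 - q j) * exp z \<le> (1 - \<eta>) * exp (- z) + \<eta> * exp z"
    proof -
      have "(q j - (1 - \<eta>)) * exp (- z) \<le> (q j - (1 - \<eta>)) * exp z"
        using qj z by (intro mult_left_mono) auto
      then show ?thesis by (simp add: algebra_simps)
    qed
    have same: "q j * c + (1 - q j) * c = c" for c :: real by (simp add: algebra_simps)
    have nbj: "j \<in> ?nb \<longleftrightarrow> distd d (X i) (X j) \<le> r" using j by (auto simp: neighbors_def)
    show "q j * f j (t j) + (1 - q j) * f j (\<not> t j) \<le> weight d r w z \<eta> E F j (X i) (X j)"
      using mix same by (auto simp: f_def weight_def nbj vote_def t_def)
  qed
  also have "\<dots> = tail_bound d r w z \<eta> N E F \<rho> i X"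
    using True by (simp add: tail_bound_def)
  finally show ?thesis .
qed (simp add: tail_bound_def)

section \<open>The uniform distribution on the ball\<close>

lemma prob_space_unif_ball: "d \<ge> 1 \<Longrightarrow> prob_space (unif_ball d)"
  unfolding unif_ball_def using emeasure_unit_ball[of d]
  by (intro prob_space_uniform_measure) auto

lemma sets_unif_ball [measurable_cong]: "sets (unif_ball d) = sets (Rd d)"
  by (simp add: unif_ball_def)

lemma AE_unif_ball: "AE x in unif_ball d. x \<in> unit_ball d"
  unfolding unif_ball_def by (rule AE_uniform_measureI) auto

lemma measure_unif_ball:
  assumes "d \<ge> 1" "A \<in> sets (Rd d)" "A \<subseteq> unit_ball d"
  shows "measure (unif_ball d) A = measure (Rd d) A / measure (Rd d) (unit_ball d)"
  using emeasure_unit_ball[OF assms(1)] assms(2,3)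
  by (simp add: unif_ball_def Int_absorb1)

lemma measure_unit_ball_pos: "d \<ge> 1 \<Longrightarrow> measure (Rd d) (unit_ball d) > 0"
  using emeasure_unit_ball[of d] by (simp add: measure_def enn2real_positive_iff)

lemma distd_measurable [measurable (raw)]:
  assumes [measurable]: "f \<in> measurable M (Rd d)" "g \<in> measurable M (Rd d)"
  shows "(\<lambda>x. distd d (f x) (g x)) \<in> borel_measurable M"
proof -
  have [measurable]: "(\<lambda>x. h x j) \<in> borel_measurable M" if "j < d" "h \<in> measurable M (Rd d)" for h j
    using measurable_comp[OF that(2) component_measurable[OF that(1)]] by (simp add: comp_def)
  have "(\<lambda>x. \<Sum>j<d. (f x j - g x j)^2) \<in> borel_measurable M"
    by (rule borel_measurable_sum) measurable
  then show ?thesis unfolding distd_def by measurable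
qed

lemma weight_measurable [measurable (raw)]:
  assumes [measurable]: "f \<in> measurable M (Rd d)" "g \<in> measurable M (Rd d)"
  shows "(\<lambda>x. weight d r w z \<eta> E F j (f x) (g x)) \<in> borel_measurable M"
  unfolding weight_def by measurable

lemma tail_bound_measurable:
  assumes "i < N"
  shows "tail_bound d r w z \<eta> N E F \<rho> i \<in> borel_measurable (PiM {..<N} (\<lambda>_. unif_ball d))"
proof -
  have [measurable]: "(\<lambda>X. X j) \<in> PiM {..<N} (\<lambda>_. unif_ball d) \<rightarrow>\<^sub>M Rd d" if "j < N" for j
    using measurable_component_singleton[of j "{..<N}" "\<lambda>_. unif_ball d"] that
    by (simp add: measurable_cong_sets[OF refl sets_unif_ball])
  have [measurable]: "(\<lambda>X. \<Prod>j\<in>{..<N} - {i}. weight d r w z \<eta> E F j (X i) (X j)) \<in> borel_measurable (PiM {..<N} (\<lambda>_. unif_ball d))"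
    using assms by (intro borel_measurable_prod weight_measurable) auto
  have [measurable]: "(\<lambda>X. X i) \<in> PiM {..<N} (\<lambda>_. unif_ball d) \<rightarrow>\<^sub>M Rd d" using assms by simp
  show ?thesis unfolding tail_bound_def[abs_def] by measurable
qed

text \<open>Multiply by \<open>exp z \<ge> 1 + z\<close> and use
  \<open>(1 - z + z^2) * (1 + z) = 1 + z^3\<close>.\<close>

lemma exp_minus_le: "0 \<le> z \<Longrightarrow> exp (- z) \<le> 1 - z + (z::real)^2"
proof -
  assume z: "0 \<le> z"
  have "1 \<le> (1 - z + z^2) * (1 + z)"
    using z by (simp add: algebra_simps power2_eq_square)
  also have "\<dots> \<le> (1 - z + z^2) * exp z"
  proof (rule mult_left_mono)
    have "1 - z + z^2 = (z - 1/2)^2 + 3/4" by (simp add: power2_eq_square algebra_simps)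
    then show "0 \<le> 1 - z + z^2" by simp
  qed simp
  finally show ?thesis by (simp add: exp_minus field_simps)
qed

text \<open>If \<open>\<rho> = 2 * r\<close>, the whole neighbourhood of \<open>x\<close> is at distance more than \<open>r\<close> from the
  separator, so that every \<open>j \<in> E\<close> is trusted; this improves the constant \<open>c\<close> to \<open>- z\<close>.\<close>

lemma expected_weight_le:
  assumes d: "d \<ge> 1" and r: "0 < r" "144 * r * sqrt (real d) \<le> \<gamma>" and \<gamma>: "0 < \<gamma>" "\<gamma> \<le> 1/2" "\<gamma> = 1/2 - \<eta>"
    and w: "(\<Sum>j<d. (w j)^2) = 1" and x: "x \<in> unit_ball d" and wx: "\<bar>dotp d w x\<bar> > \<rho>"
    and z: "0 \<le> z" "z \<le> 1"
    and c: "\<rho> = r \<and> c = \<gamma> * z / 4 \<or> \<rho> = 2 * r \<and> c = - z"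
  shows "(\<integral>\<^sup>+y. ennreal (weight d r w z \<eta> E F j x y) \<partial>unif_ball d)
    \<le> ennreal (exp (measure (unif_ball d) (nbhd d r x) *
        (z^2 + (if j \<in> E then c else if j \<in> F then - 2 * \<gamma> * z else z))))"
proof -
  interpret P: prob_space "unif_ball d" by (rule prob_space_unif_ball[OF d])
  have r0: "r \<ge> 0" and \<eta>: "0 \<le> \<eta>" "\<eta> \<le> 1" using r \<gamma> by auto
  let ?C = "nbhd d r x" and ?A = "{y \<in> nbhd d r x. \<bar>dotp d w y\<bar> > r}"
  have Cs: "?C \<in> sets (Rd d)" and As: "?A \<in> sets (Rd d)"
    unfolding nbhd_eq[OF r0] by measurable
  define p a where "p = measure (unif_ball d) ?C" and "a = measure (unif_ball d) ?A"
  have p0: "p \<ge> 0" by (simp add: p_def)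
  have ap: "a \<le> p" unfolding a_def p_def
    by (rule P.finite_measure_mono) (use Cs in \<open>auto simp: sets_unif_ball\<close>)
  have DA: "measure (unif_ball d) (?C - ?A) = p - a"
    unfolding p_def a_def using Cs As
    by (intro P.finite_measure_Diff) (auto simp: sets_unif_ball)
  \<comment> \<open>On the ball, the weight minus 1 is a step function: \<open>\<alpha>\<close> on
    the far part \<open>?A\<close> of the neighbourhood, \<open>\<beta>\<close> on the rest of it,
    and 0 elsewhere.\<close>
  define \<alpha> where "\<alpha> = (if j \<in> E then exp (- z) else if j \<in> F then (1 - \<eta>) * exp (- z) + \<eta> * exp z else exp z) - 1"
  define \<beta> where "\<beta> = (if j \<notin> E \<and> j \<in> F then (1 - \<eta>) * exp (- z) + \<eta> * exp z else exp z) - 1"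
  let ?f = "\<lambda>y. 1 + \<alpha> * indicator ?A y + \<beta> * indicator (?C - ?A) y"
  have AEf: "AE y in unif_ball d. weight d r w z \<eta> E F j x y = ?f y"
    using AE_unif_ball
  proof eventually_elim
    case (elim y)
    then show ?case by (auto simp: weight_def \<alpha>_def \<beta>_def nbhd_def indicator_def)
  qed
  have int: "integrable (unif_ball d) ?f"
    using Cs As by (intro Bochner_Integration.integrable_add integrable_mult_right integrable_real_indicator)
      (auto simp: sets_unif_ball P.emeasure_eq_measure)
  have "(\<integral>\<^sup>+y. ennreal (weight d r w z \<eta> E F j x y) \<partial>unif_ball d) = (\<integral>\<^sup>+y. ennreal (?f y) \<partial>unif_ball d)"
    by (rule nn_integral_cong_AE) (use AEf in auto)
  also have "\<dots> = ennreal (\<integral>y. ?f y \<partial>unif_ball d)"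
  proof (rule nn_integral_eq_integral[OF int])
    show "AE y in unif_ball d. 0 \<le> ?f y"
      using AEf
    proof eventually_elim
      case (elim y)
      then show ?case using weight_nonneg[OF \<eta>] by metis
    qed
  qed
  also have "(\<integral>y. ?f y \<partial>unif_ball d) = 1 + \<alpha> * a + \<beta> * (p - a)"
  proof -
    have "(\<integral>y. ?f y \<partial>unif_ball d) = (\<integral>y. 1 + \<alpha> * indicator ?A y \<partial>unif_ball d) + (\<integral>y. \<beta> * indicator (?C - ?A) y \<partial>unif_ball d)"
      using Cs As by (intro Bochner_Integration.integral_add Bochner_Integration.integrable_add integrable_mult_right integrable_real_indicator)
        (auto simp: sets_unif_ball P.emeasure_eq_measure)
    also have "(\<integral>y. 1 + \<alpha> * indicator ?A y \<partial>unif_ball d) = (\<integral>y. 1 \<partial>unif_ball d) + (\<integral>y. \<alpha> * indicator ?A y \<partial>unif_ball d)"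
      using As by (intro Bochner_Integration.integral_add integrable_mult_right integrable_real_indicator)
        (auto simp: sets_unif_ball P.emeasure_eq_measure)
    also have "(\<integral>y. \<alpha> * indicator ?A y \<partial>unif_ball d) = \<alpha> * a"
      using As by (simp add: a_def sets_unif_ball)
    also have "(\<integral>y. \<beta> * indicator (?C - ?A) y \<partial>unif_ball d) = \<beta> * (p - a)"
      using Cs As by (subst DA[symmetric]) (simp add: sets_unif_ball)
    finally show ?thesis by (simp add: P.prob_space)
  qed
  also have "1 + \<alpha> * a + \<beta> * (p - a) \<le> 1 + p * (z^2 + (if j \<in> E then c else if j \<in> F then - 2 * \<gamma> * z else z))"
  proof -
    have e1: "exp (- z) \<le> 1 - z + z^2" by (rule exp_minus_le[OF z(1)])
    have e2: "exp z \<le> 1 + z + z^2" by (rule exp_bound[OF z])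
    have e3: "exp (- z) \<ge> 1 - z" using exp_ge_add_one_self[of "- z"] by simp
    have z2: "z^2 \<le> z" using z by (simp add: power2_eq_square mult_left_le)
    consider "j \<in> E" "\<rho> = r" "c = \<gamma> * z / 4" | "j \<in> E" "\<rho> = 2 * r" "c = - z" | "j \<notin> E" "j \<in> F" | "j \<notin> E" "j \<notin> F"
      using c by blast
    then show ?thesis
    proof cases
      case 1
      have "a \<ge> (1/2 - \<gamma>/12) * p"
      proof -
        let ?V = "measure (Rd d) (unit_ball d)"
        have "p = measure (Rd d) ?C / ?V" "a = measure (Rd d) ?A / ?V"
          unfolding p_def a_def using Cs As by (auto intro!: measure_unif_ball d simp: nbhd_def)
        then show ?thesis
          using divide_right_mono[OF measure_far_half[OF d r \<gamma>(2) w x wx[unfolded 1(2)]], of ?V] by simp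
      qed
      \<comment> \<open>The mean decreases in \<open>a\<close>, so the lower bound on the far part
        applies. Then \<open>exp z - exp (- z) \<le> 3 * z\<close> turns the defect
        \<open>\<gamma>/12\<close> into \<open>\<gamma> * z / 4\<close>.\<close>
      then have "(exp z - exp (- z)) * ((1/2 - \<gamma>/12) * p) \<le> (exp z - exp (- z)) * a"
        using z by (intro mult_left_mono) auto
      moreover have "\<alpha> * a + \<beta> * (p - a) = p * (exp z - 1) - (exp z - exp (- z)) * a"
        using 1 by (simp add: \<alpha>_def \<beta>_def algebra_simps)
      moreover have "p * (exp z - 1) - (exp z - exp (- z)) * ((1/2 - \<gamma>/12) * p)
          = p * ((exp z + exp (- z)) / 2 - 1 + (exp z - exp (- z)) * (\<gamma>/12))"
        by (simp add: algebra_simps)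
      moreover have "(exp z - exp (- z)) * (\<gamma>/12) \<le> (3 * z) * (\<gamma>/12)"
        using e2 e3 z2 \<gamma> by (intro mult_right_mono) auto
      then have "(exp z + exp (- z)) / 2 - 1 + (exp z - exp (- z)) * (\<gamma>/12) \<le> z^2 + \<gamma> * z / 4"
      proof -
        have "(exp z + exp (- z)) / 2 - 1 \<le> z^2" using add_mono[OF e1 e2] by argo
        moreover have "(3 * z) * (\<gamma>/12) = \<gamma> * z / 4" by simp
        ultimately show ?thesis using \<open>(exp z - exp (- z)) * (\<gamma>/12) \<le> (3 * z) * (\<gamma>/12)\<close> by linarith
      qed
      then have "p * ((exp z + exp (- z)) / 2 - 1 + (exp z - exp (- z)) * (\<gamma>/12)) \<le> p * (z^2 + \<gamma> * z / 4)"
        using p0 by (rule mult_left_mono)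
      ultimately have "\<alpha> * a + \<beta> * (p - a) \<le> p * (z^2 + \<gamma> * z / 4)" by argo
      then show ?thesis unfolding 1(3) using 1(1) by simp
    next
      case 2
      have "?A = ?C"
        using dotp_diff_le_distd[OF w r0, of x] wx 2 by (force simp: nbhd_def)
      then have "a = p" by (simp add: a_def p_def)
      moreover have "p * (exp (- z) - 1) \<le> p * (z^2 - z)"
        using e1 p0 by (intro mult_left_mono) auto
      ultimately show ?thesis using 2 by (simp add: \<alpha>_def algebra_simps)
    next
      case 3
      have "(1 - \<eta>) * exp (- z) + \<eta> * exp z \<le> (1 - \<eta>) * (1 - z + z^2) + \<eta> * (1 + z + z^2)"
        using e1 e2 \<eta> by (intro add_mono mult_left_mono) auto
      also have "\<dots> = 1 + (z^2 + - 2 * \<gamma> * z)" unfolding \<gamma>(3) by (simp add: algebra_simps)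
      finally have "p * ((1 - \<eta>) * exp (- z) + \<eta> * exp z - 1) \<le> p * (z^2 + - 2 * \<gamma> * z)"
        using p0 by (intro mult_left_mono) auto
      then show ?thesis using 3 by (simp add: \<alpha>_def \<beta>_def algebra_simps)
    next
      case 4
      have "p * (exp z - 1) \<le> p * (z^2 + z)"
        using e2 p0 by (intro mult_left_mono) auto
      then show ?thesis using 4 by (simp add: \<alpha>_def \<beta>_def algebra_simps)
    qed
  qed
  also have "\<dots> \<le> exp (p * (z^2 + (if j \<in> E then c else if j \<in> F then - 2 * \<gamma> * z else z)))"
    by (rule exp_ge_add_one_self)
  finally show ?thesis by (simp add: p_def ennreal_leI)
qed

lemma prob_nbhd_ge:
  assumes "d \<ge> 1" "0 < r" "r \<le> 1" "x \<in> unit_ball d"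
  shows "measure (unif_ball d) (nbhd d r x) \<ge> (r/2)^d"
proof -
  have "(r/2)^d * measure (Rd d) (unit_ball d) \<le> measure (Rd d) (nbhd d r x)"
    by (rule measure_nbhd_ge[OF assms])
  then show ?thesis
    using measure_unit_ball_pos[OF assms(1)] assms
    by (subst measure_unif_ball) (auto simp: nbhd_def field_simps intro!: nbhd_sets[unfolded nbhd_def])
qed

text \<open>Given the position of sensor \<open>i\<close>, the other positions are independent, so
  the expected product factorizes and the exponents add up. The left side of \<open>S\<close> bounds
  their sum, up to the factor \<open>p\<close>: each sensor costs \<open>z^2\<close>, and sensors in
  \<open>E\<close>, in \<open>F\<close> and in neither add \<open>c\<close>,
  \<open>- 2 * \<gamma> * z\<close> and \<open>z\<close>.\<close>

lemma expected_tail_bound: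
  assumes d: "d \<ge> 1" and r: "0 < r" "144 * r * sqrt (real d) \<le> \<gamma>" and \<gamma>: "0 < \<gamma>" "\<gamma> \<le> 1/2" "\<gamma> = 1/2 - \<eta>"
    and w: "(\<Sum>j<d. (w j)^2) = 1"
    and z: "0 \<le> z" "z \<le> 1"
    and c: "\<rho> = r \<and> c = \<gamma> * z / 4 \<or> \<rho> = 2 * r \<and> c = - z"
    and i: "i < N" and EF: "E \<subseteq> {..<N} - {i}" "F \<subseteq> {..<N} - {i}" "E \<inter> F = {}"
    and S: "real N * z^2 + real (card E) * c - real (card F) * (2 * \<gamma> * z)
       + (real N - 1 - real (card E) - real (card F)) * z \<le> - B" "B \<ge> 0"
  shows "(\<integral>\<^sup>+X. ennreal (tail_bound d r w z \<eta> N E F \<rho> i X) \<partial>PiM {..<N} (\<lambda>_. unif_ball d))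
     \<le> ennreal (exp (- ((r/2)^d * B)))"
proof -
  interpret P: prob_space "unif_ball d" by (rule prob_space_unif_ball[OF d])
  interpret Q: product_sigma_finite "\<lambda>_::nat. unif_ball d"
    unfolding product_sigma_finite_def using P.sigma_finite_measure_axioms by simp
  have \<eta>: "0 \<le> \<eta>" "\<eta> \<le> 1" using \<gamma> by auto
  define J where "J = {..<N} - {i}"
  have J: "{..<N} = insert i J" "i \<notin> J" "finite J" "E \<subseteq> J" "F \<subseteq> J" using i EF by (auto simp: J_def)
  have cJ: "real (card J) = real N - 1" using i by (simp add: J_def of_nat_diff)
  define e where "e j = z^2 + (if j \<in> E then c else if j \<in> F then - 2 * \<gamma> * z else z)" for j
  have fin: "finite E" "finite F" using J finite_subset by blast+
  have sum_e: "(\<Sum>j\<in>J. e j) \<le> - B"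
  proof -
    have "(\<Sum>j\<in>J. if j \<in> E then c else if j \<in> F then - 2 * \<gamma> * z else z)
       = (\<Sum>j\<in>J. z + (if j \<in> E then c - z else 0) + (if j \<in> F then - 2 * \<gamma> * z - z else 0))"
      using EF(3) by (intro sum.cong) auto
    also have "\<dots> = real (card J) * z + real (card E) * (c - z) + real (card F) * (- 2 * \<gamma> * z - z)"
      using J by (simp add: sum.distrib sum.inter_restrict[symmetric] Int_absorb1)
    finally have "(\<Sum>j\<in>J. e j) = real (card J) * z^2 + (real (card J) * z + real (card E) * (c - z) + real (card F) * (- 2 * \<gamma> * z - z))"
      by (simp add: e_def sum.distrib)
    also have "\<dots> = real N * z^2 + real (card E) * c - real (card F) * (2 * \<gamma> * z)
       + (real N - 1 - real (card E) - real (card F)) * z - z^2"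
      unfolding cJ by (simp add: algebra_simps)
    finally show ?thesis using S(1) by (smt (verit) zero_le_power2)
  qed
  have [measurable]: "(\<lambda>X. ennreal (tail_bound d r w z \<eta> N E F \<rho> i X)) \<in> borel_measurable (PiM {..<N} (\<lambda>_. unif_ball d))"
    using tail_bound_measurable[OF i] by measurable
  have "(\<integral>\<^sup>+X. ennreal (tail_bound d r w z \<eta> N E F \<rho> i X) \<partial>PiM {..<N} (\<lambda>_. unif_ball d))
      = (\<integral>\<^sup>+x. \<integral>\<^sup>+X. ennreal (tail_bound d r w z \<eta> N E F \<rho> i (X(i := x))) \<partial>PiM J (\<lambda>_. unif_ball d) \<partial>unif_ball d)"
    unfolding J(1)
    by (rule Q.product_nn_integral_insert_rev[OF J(3,2)]) (simp flip: J(1))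
  also have "\<dots> \<le> (\<integral>\<^sup>+x. ennreal (exp (- ((r/2)^d * B))) \<partial>unif_ball d)"
  proof (rule nn_integral_mono_AE)
    show "AE x in unif_ball d. (\<integral>\<^sup>+X. ennreal (tail_bound d r w z \<eta> N E F \<rho> i (X(i := x))) \<partial>PiM J (\<lambda>_. unif_ball d))
       \<le> ennreal (exp (- ((r/2)^d * B)))"
      using AE_unif_ball
    proof eventually_elim
      case (elim x)
      have xs: "x \<in> space (Rd d)" using elim by (simp add: unit_ball_def)
      show ?case
      proof (cases "\<bar>dotp d w x\<bar> > \<rho>")
        case True
        define p where "p = measure (unif_ball d) (nbhd d r x)"
        have "1 \<le> sqrt (real d)" using d by simp
        then have "r * 1 \<le> r * sqrt (real d)" using r by (intro mult_left_mono) auto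
        then have "r \<le> 1" using r \<gamma> by linarith
        then have p: "(r/2)^d \<le> p" unfolding p_def using d r elim by (intro prob_nbhd_ge) auto
        have "(\<integral>\<^sup>+X. ennreal (tail_bound d r w z \<eta> N E F \<rho> i (X(i := x))) \<partial>PiM J (\<lambda>_. unif_ball d))
           = (\<integral>\<^sup>+X. (\<Prod>j\<in>J. ennreal (weight d r w z \<eta> E F j x (X j))) \<partial>PiM J (\<lambda>_. unif_ball d))"
        proof (rule nn_integral_cong)
          fix X
          have "tail_bound d r w z \<eta> N E F \<rho> i (X(i := x)) = (\<Prod>j\<in>J. weight d r w z \<eta> E F j x (X j))"
            using True J(2) unfolding tail_bound_def J_def[symmetric] by (auto intro!: prod.cong)
          then show "ennreal (tail_bound d r w z \<eta> N E F \<rho> i (X(i := x))) = (\<Prod>j\<in>J. ennreal (weight d r w z \<eta> E F j x (X j)))"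
            by (simp add: prod_ennreal weight_nonneg[OF \<eta>])
        qed
        also have "\<dots> = (\<Prod>j\<in>J. \<integral>\<^sup>+y. ennreal (weight d r w z \<eta> E F j x y) \<partial>unif_ball d)"
        proof (rule Q.product_nn_integral_prod[OF J(3)])
          fix j
          have "(\<lambda>y. weight d r w z \<eta> E F j x y) \<in> borel_measurable (unif_ball d)"
            by (intro weight_measurable measurable_const xs measurable_ident_sets sets_unif_ball)
          then show "(\<lambda>y. ennreal (weight d r w z \<eta> E F j x y)) \<in> borel_measurable (unif_ball d)" by measurable
        qed
        also have "\<dots> \<le> (\<Prod>j\<in>J. ennreal (exp (p * e j)))"
          unfolding p_def e_def
          by (intro prod_mono_ennreal expected_weight_le[OF d r \<gamma> w elim True z c])
        also have "\<dots> = ennreal (exp (p * (\<Sum>j\<in>J. e j)))"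
          using J(3) by (simp add: prod_ennreal exp_sum sum_distrib_left)
        also have "\<dots> \<le> ennreal (exp (- ((r/2)^d * B)))"
        proof -
          \<comment> \<open>The exponent is at most \<open>- p * B\<close> with
            \<open>B \<ge> 0\<close>, so the uniform lower bound \<open>(r/2)^d\<close> for
            \<open>p\<close> can replace it.\<close>
          have "p * (\<Sum>j\<in>J. e j) \<le> p * (- B)" using sum_e by (intro mult_left_mono) (auto simp: p_def)
          moreover have "(r/2)^d * B \<le> p * B" using p S(2) by (rule mult_right_mono)
          ultimately show ?thesis by (intro ennreal_leI) simp
        qed
        finally show ?thesis .
      next
        case False
        then show ?thesis by (simp add: tail_bound_def)
      qed
    qed
  qed
  also have "\<dots> = ennreal (exp (- ((r/2)^d * B)))"
    by (simp add: P.emeasure_space_1)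
  finally show ?thesis .
qed

section \<open>Random-order dynamics\<close>

text \<open>With \<open>a = (r/2)^d * \<gamma>^2 / 64\<close> and \<open>512 = 8 * 64\<close> the
  hypothesis reads \<open>a * n \<ge> 8 * L\<close>. Half of the exponent absorbs the factor
  \<open>n\<close> of the union bound; the other half leaves
  \<open>(r^d * \<gamma> * \<delta>)^4 \<le> a * \<delta>\<close>.\<close>

lemma sample_size_tail:
  fixes r \<gamma> \<delta> n :: real
  assumes d: "d \<ge> 1" and r: "0 < r" "r \<le> 1/8" and \<gamma>: "0 < \<gamma>" "\<gamma> \<le> 1/2" and \<delta>: "0 < \<delta>" "\<delta> < 1"
    and n: "n \<ge> 512 / ((r/2)^d * \<gamma>^2) * ln (1 / (r^d * \<gamma> * \<delta>))"
  shows "n \<ge> 2" "n * exp (- ((r/2)^d * (n * \<gamma>^2 / 64))) \<le> \<delta>"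
proof -
  define a L where "a = (r/2)^d * \<gamma>^2 / 64" and "L = ln (1 / (r^d * \<gamma> * \<delta>))"
  have a0: "a > 0" using r \<gamma> by (simp add: a_def)
  have u0: "r^d > 0" "r^d * \<gamma> * \<delta> > 0" using r \<gamma> \<delta> by auto
  have "r^d \<le> r^1" using r d by (intro power_decreasing) auto
  then have u8: "r^d \<le> 1/8" using r by simp
  have an: "a * n \<ge> 8 * L"
  proof -
    have "a * n \<ge> a * (512 / ((r/2)^d * \<gamma>^2) * L)"
      using n a0 unfolding L_def by (intro mult_left_mono) auto
    also have "a * (512 / ((r/2)^d * \<gamma>^2) * L) = 8 * L"
      using r \<gamma> by (simp add: a_def)
    finally show ?thesis .
  qed
  have "r^d * \<gamma> * \<delta> \<le> 1 * (1/2) * 1"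
    using u8 u0 \<gamma> \<delta> by (intro mult_mono) auto
  then have "ln 2 \<le> L"
    unfolding L_def using u0 by (simp add: ln_mono field_simps)
  moreover have "ln 2 \<ge> (1/2::real)"
    by (subst ln_ge_iff) (auto intro: exp_half_le2)
  ultimately have L: "L \<ge> 1/2" by simp
  have "a \<le> 1"
  proof -
    have "(r/2)^d * \<gamma>^2 \<le> 1 * 1"
      using r \<gamma> by (intro mult_mono power_le_one) auto
    then show ?thesis by (simp add: a_def)
  qed
  have an4: "4 \<le> a * n" using an L by linarith
  have "n > 0" using an4 a0 by (smt (verit) mult_nonneg_nonpos)
  then have "a * n \<le> 1 * n" using \<open>a \<le> 1\<close> by (intro mult_right_mono) auto
  then show "n \<ge> 2" using an4 by linarith
  define h where "h = a * n / 2"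
  have h0: "h \<ge> 0" using an4 by (simp add: h_def)
  have "2 * h \<le> 1 + h + h^2 / 2"
    using zero_le_power2[of "h - 1"] by (simp add: power2_eq_square algebra_simps)
  also have "\<dots> \<le> exp h" by (rule exp_lower_Taylor_quadratic[OF h0])
  finally have "2 * h \<le> exp h" .
  then have "2 * h * exp (- (2 * h)) \<le> exp h * exp (- (2 * h))"
    by (intro mult_right_mono) auto
  also have "\<dots> = exp (- h)" by (simp add: exp_add[symmetric])
  also have "\<dots> \<le> exp (- (4 * L))" using an by (simp add: h_def)
  also have "\<dots> = (r^d * \<gamma> * \<delta>)^4"
  proof -
    have "exp L = 1 / (r^d * \<gamma> * \<delta>)" unfolding L_def by (rule exp_ln) (use u0 in simp)
    then have "exp (- L) = r^d * \<gamma> * \<delta>" by (simp add: exp_minus)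
    moreover have "exp (- (4 * L)) = exp (- L) ^ 4"
      by (simp add: exp_of_nat_mult[symmetric])
    ultimately show ?thesis by simp
  qed
  also have "\<dots> \<le> a * \<delta>"
  proof -
    have "(2 * r)^d \<le> 1" using r by (intro power_le_one) auto
    then have p2: "2^d * r^d \<le> 1" by (simp add: power_mult_distrib)
    \<comment> \<open>Of the four factors \<open>r^d\<close>, one cancels \<open>2^d\<close>, two
      supply the \<open>1/64\<close> in \<open>a\<close>, and one remains.\<close>
    have "(r^d)^4 * 2^d = (2^d * r^d) * ((r^d)^2 * r^d)" by (simp add: power2_eq_square power4_eq_xxxx)
    also have "\<dots> \<le> 1 * ((1/8)^2 * r^d)"
      using p2 u8 u0 r by (intro mult_mono power_mono) auto
    finally have "(r^d)^4 \<le> (r/2)^d / 64" by (simp add: power_divide field_simps)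
    moreover have "\<gamma>^4 \<le> \<gamma>^2" using \<gamma> by (intro power_decreasing) auto
    moreover have "\<delta>^4 \<le> \<delta>^1" using \<delta> by (intro power_decreasing) auto
    ultimately have "(r^d)^4 * \<gamma>^4 * \<delta>^4 \<le> (r/2)^d / 64 * \<gamma>^2 * \<delta>^1"
      using r \<gamma> \<delta> by (intro mult_mono) auto
    then show ?thesis by (simp add: a_def power_mult_distrib)
  qed
  finally have "a * (n * exp (- (a * n))) \<le> a * \<delta>" by (simp add: h_def mult.assoc)
  then have "n * exp (- (a * n)) \<le> \<delta>" using a0 by simp
  moreover have "(r/2)^d * (n * \<gamma>^2 / 64) = a * n" by (simp add: a_def)
  ultimately show "n * exp (- ((r/2)^d * (n * \<gamma>^2 / 64))) \<le> \<delta>" by (simp only:)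
qed

text \<open>The two phases. In the second one only the sensors updated in the first phase count as
  updated, and all others are treated as adversarial.\<close>

definition early_time :: "nat \<Rightarrow> nat" where "early_time N = 3 * N div 4"

definition updated :: "nat \<Rightarrow> (nat \<Rightarrow> nat) \<Rightarrow> nat \<Rightarrow> nat set" where
  "updated N prm k = prm ` {..<min k (early_time N)}"

definition pending :: "nat \<Rightarrow> (nat \<Rightarrow> nat) \<Rightarrow> nat \<Rightarrow> nat set" where
  "pending N prm k = (if k < early_time N then prm ` {k<..<N} else {})"

definition threshold :: "nat \<Rightarrow> real \<Rightarrow> nat \<Rightarrow> real" where
  "threshold N r k = (if k < early_time N then r else 2 * r)"

text \<open>Union bound over the update times with \<open>z = \<gamma>/8\<close>. In units of
  \<open>\<gamma>^2\<close>, a sensor costs \<open>1/64\<close> in second order, an updated one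
  \<open>1/32\<close> more in the first phase, while a pending one gains \<open>1/4\<close>.\<close>

definition failure_bound :: "nat \<Rightarrow> real \<Rightarrow> (nat \<Rightarrow> real) \<Rightarrow> real \<Rightarrow> nat \<Rightarrow> (nat \<Rightarrow> nat) \<Rightarrow> (nat \<Rightarrow> nat \<Rightarrow> real) \<Rightarrow> real" where
  "failure_bound d r w \<eta> N prm X = (\<Sum>k<N. tail_bound d r w ((1/2 - \<eta>) / 8) \<eta> N
     (updated N prm k) (pending N prm k) (threshold N r k) (prm k) X)"

lemma permutes_less: "prm permutes {..<N} \<Longrightarrow> k < N \<Longrightarrow> prm k < N"
  using permutes_in_image[of prm "{..<N}" k] by simp

text \<open>If no update time is bad, the margins force the good event, so failure is dominated by
  the number of bad times. This holds for each \<open>s0\<close> separately, hence the tie-breaking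
  rule may depend on \<open>s0\<close>.\<close>

lemma prob_good_event_ge:
  assumes w: "(\<Sum>j<d. (w j)^2) = 1" and r: "r \<ge> 0" and prm: "prm permutes {..<N}"
    and q: "\<And>j. j < N \<Longrightarrow> 1 - \<eta> \<le> q j \<and> q j \<le> 1" and \<eta>: "0 \<le> \<eta>" "\<eta> < 1/2"
  shows "(\<Sum>s0\<in>{..<N} \<rightarrow>\<^sub>E (UNIV :: bool set). state_prob d w N X q s0 * of_bool (good_event d r w N X prm (tb s0) s0))
    \<ge> 1 - failure_bound d r w \<eta> N prm X"
proof -
  let ?bad = "\<lambda>k s0. \<bar>dotp d w (X (prm k))\<bar> > threshold N r k \<and>
    margin d r w N (updated N prm k) (pending N prm k) (prm k) X s0 \<le> 0"
  let ?S = "{..<N} \<rightarrow>\<^sub>E (UNIV :: bool set)"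
  have sp: "state_prob d w N X q s0 \<ge> 0" for s0
    by (rule state_prob_nonneg) (use q \<eta> in force)
  have "1 - of_bool (good_event d r w N X prm (tb s0) s0) \<le> (\<Sum>k<N. of_bool (?bad k s0) :: real)" for s0
  proof (cases "\<exists>k<N. ?bad k s0")
    case True
    then obtain k where "k < N" "?bad k s0" by blast
    then have "1 \<le> (\<Sum>k<N. of_bool (?bad k s0) :: real)"
      using member_le_sum[of k "{..<N}" "\<lambda>k. of_bool (?bad k s0) :: real"] by simp
    then show ?thesis by (cases "good_event d r w N X prm (tb s0) s0") auto
  next
    case False
    have "good_event d r w N X prm (tb s0) s0"
    proof (rule good_event_if_margins[OF w r prm, of "early_time N"])
      show "early_time N \<le> N" by (simp add: early_time_def)
      then show "margin d r w N (prm ` {..<k}) (prm ` {k<..<N}) (prm k) X s0 > 0"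
        if "k < early_time N" "\<bar>dotp d w (X (prm k))\<bar> > r" for k
        using False[simplified, rule_format, of k] that
        by (simp add: updated_def pending_def threshold_def min_def not_le)
      show "margin d r w N (prm ` {..<early_time N}) {} (prm k) X s0 > 0"
        if "early_time N \<le> k" "k < N" "\<bar>dotp d w (X (prm k))\<bar> > 2 * r" for k
        using False[simplified, rule_format, of k] that
        by (simp add: updated_def pending_def threshold_def min.absorb2 not_le)
    qed
    then show ?thesis by (simp add: sum_nonneg)
  qed
  then have "(\<Sum>s0\<in>?S. state_prob d w N X q s0 * (1 - of_bool (good_event d r w N X prm (tb s0) s0)))
      \<le> (\<Sum>s0\<in>?S. state_prob d w N X q s0 * (\<Sum>k<N. of_bool (?bad k s0)))"
    by (intro sum_mono mult_left_mono sp)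
  also have "\<dots> = (\<Sum>k<N. \<Sum>s0\<in>?S. state_prob d w N X q s0 * of_bool (?bad k s0))"
    unfolding sum_distrib_left by (rule sum.swap)
  also have "\<dots> \<le> failure_bound d r w \<eta> N prm X"
    unfolding failure_bound_def
    by (intro sum_mono prob_margin_le) (use q \<eta> permutes_less[OF prm] in auto)
  finally show ?thesis
    by (simp add: right_diff_distrib sum_subtractf sum_state_prob)
qed

lemma expected_failure_bound:
  assumes d: "d \<ge> 1" and r: "0 < r" "144 * r * sqrt (real d) \<le> \<gamma>" and \<gamma>: "0 < \<gamma>" "\<gamma> \<le> 1/2" "\<gamma> = 1/2 - \<eta>"
    and w: "(\<Sum>j<d. (w j)^2) = 1" and prm: "prm permutes {..<N}" and N: "N \<ge> 2"
  shows "(\<integral>\<^sup>+X. ennreal (failure_bound d r w \<eta> N prm X) \<partial>PiM {..<N} (\<lambda>_. unif_ball d))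
     \<le> ennreal (real N * exp (- ((r/2)^d * (real N * \<gamma>^2 / 64))))"
proof -
  let ?Q = "PiM {..<N} (\<lambda>_. unif_ball d)"
  let ?t = "\<lambda>k X. tail_bound d r w (\<gamma> / 8) \<eta> N (updated N prm k) (pending N prm k) (threshold N r k) (prm k) X"
  let ?m = "early_time N"
  have \<eta>: "0 \<le> \<eta>" "\<eta> \<le> 1" using \<gamma> by auto
  have inj: "inj prm" by (rule permutes_inj[OF prm])
  have inj': "inj_on prm A" for A using inj by (rule inj_on_subset) simp
  have mN: "4 * ?m \<le> 3 * N" "3 * N \<le> 4 * ?m + 3" by (auto simp: early_time_def)
  have img: "prm ` A \<subseteq> {..<N} - {prm k}" if "A \<subseteq> {..<N} - {k}" for A k
    using that permutes_less[OF prm] inj by (auto simp: inj_eq)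
  have bound: "(\<integral>\<^sup>+X. ennreal (?t k X) \<partial>?Q) \<le> ennreal (exp (- ((r/2)^d * (real N * \<gamma>^2 / 64))))"
    if k: "k < N" for k
  proof (cases "k < ?m")
    case True
    have E: "card (updated N prm k) = k" and F: "card (pending N prm k) = N - 1 - k"
      using True by (simp_all add: updated_def pending_def card_image[OF inj'])
    show ?thesis
    proof (rule expected_tail_bound[OF d r \<gamma> w])
      show "threshold N r k = r \<and> \<gamma> * (\<gamma>/8) / 4 = \<gamma> * (\<gamma>/8) / 4
          \<or> threshold N r k = 2 * r \<and> \<gamma> * (\<gamma>/8) / 4 = - (\<gamma>/8)"
        using True by (simp add: threshold_def)
      show "updated N prm k \<subseteq> {..<N} - {prm k}" "pending N prm k \<subseteq> {..<N} - {prm k}"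
        unfolding updated_def pending_def if_P[OF True] using k by (auto intro!: img)
      show "updated N prm k \<inter> pending N prm k = {}"
        using inj by (auto simp: updated_def pending_def inj_eq)
      \<comment> \<open>\<open>k < early_time N\<close> gives
        \<open>4 * (k + 1) \<le> 3 * N\<close>, so at least a quarter of all sensors are still
        pending besides \<open>prm k\<close>.\<close>
      have kN: "4 * real k \<le> 3 * real N" "4 * (real N - 1 - real k) \<ge> real N"
      proof -
        have "real (4 * (k + 1)) \<le> real (3 * N)" unfolding of_nat_le_iff
          using mult_le_mono2[of "k + 1" "early_time N" 4] True mN(1) by linarith
        then show "4 * real k \<le> 3 * real N" "4 * (real N - 1 - real k) \<ge> real N" by simp_all
      qed
      have "real N * (\<gamma>/8)^2 + real k * (\<gamma> * (\<gamma>/8) / 4) - (real N - 1 - real k) * (2 * \<gamma> * (\<gamma>/8))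
        = (real N / 64 + real k / 32 - (real N - 1 - real k) / 4) * \<gamma>^2"
        by (simp add: power2_eq_square algebra_simps)
      also have "\<dots> \<le> (- real N / 64) * \<gamma>^2"
      proof (rule mult_right_mono)
        show "real N / 64 + real k / 32 - (real N - 1 - real k) / 4 \<le> - real N / 64" using kN of_nat_0_le_iff[of N, where 'a=real] by argo
      qed simp
      finally show "real N * (\<gamma>/8)^2 + real (card (updated N prm k)) * (\<gamma> * (\<gamma>/8) / 4)
          - real (card (pending N prm k)) * (2 * \<gamma> * (\<gamma>/8))
          + (real N - 1 - real (card (updated N prm k)) - real (card (pending N prm k))) * (\<gamma>/8)
          \<le> - (real N * \<gamma>^2 / 64)"
        using k by (simp add: E F of_nat_diff diff_diff_eq)
    qed (use \<gamma> k permutes_less[OF prm] in auto)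
  next
    case False
    have E: "card (updated N prm k) = ?m" and F: "pending N prm k = {}"
      using False by (simp_all add: updated_def pending_def card_image[OF inj'])
    show ?thesis
    proof (rule expected_tail_bound[OF d r \<gamma> w])
      show "threshold N r k = r \<and> - (\<gamma>/8) = \<gamma> * (\<gamma>/8) / 4
          \<or> threshold N r k = 2 * r \<and> - (\<gamma>/8) = - (\<gamma>/8)"
        using False by (simp add: threshold_def)
      show "updated N prm k \<subseteq> {..<N} - {prm k}"
        unfolding updated_def using k by (intro img) auto
      \<comment> \<open>Rounding in \<open>early_time\<close> costs at most \<open>3/4\<close>; for
        \<open>N \<ge> 2\<close> the trusted votes still outnumber the adversarial ones by at least
        \<open>N / 4\<close>.\<close>
      have kN: "real N - 1 - 2 * real ?m \<le> - real N / 4"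
        using N mN by linarith
      have "\<gamma> * \<gamma> \<le> \<gamma> * (1/2)" using \<gamma> by (intro mult_left_mono) auto
      then have "real N * (2 * \<gamma>^2) \<le> real N * \<gamma>"
        by (intro mult_left_mono) (auto simp: power2_eq_square)
      moreover have "(real N - 1 - 2 * real ?m) * (\<gamma>/8) \<le> (- real N / 4) * (\<gamma>/8)"
        using kN \<gamma> by (intro mult_right_mono) auto
      moreover have "real N * (\<gamma>/8)^2 + real ?m * (- (\<gamma>/8)) + (real N - 1 - real ?m) * (\<gamma>/8)
          = real N * \<gamma>^2 / 64 + (real N - 1 - 2 * real ?m) * (\<gamma>/8)"
        by (simp add: power_divide field_simps)
      moreover have "(- real N / 4) * (\<gamma>/8) = - (real N * \<gamma>) / 32"
        by simp
      moreover have "0 \<le> real N * \<gamma>" using \<gamma> by simp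
      ultimately have "real N * (\<gamma>/8)^2 + real ?m * (- (\<gamma>/8)) + (real N - 1 - real ?m) * (\<gamma>/8)
          \<le> - (real N * \<gamma>^2 / 64)"
        by linarith
      then show "real N * (\<gamma>/8)^2 + real (card (updated N prm k)) * (- (\<gamma>/8))
          - real (card (pending N prm k)) * (2 * \<gamma> * (\<gamma>/8))
          + (real N - 1 - real (card (updated N prm k)) - real (card (pending N prm k))) * (\<gamma>/8)
          \<le> - (real N * \<gamma>^2 / 64)"
        by (simp add: E F)
    qed (use \<gamma> k permutes_less[OF prm] F in auto)
  qed
  have "(\<integral>\<^sup>+X. ennreal (failure_bound d r w \<eta> N prm X) \<partial>?Q) = (\<integral>\<^sup>+X. (\<Sum>k<N. ennreal (?t k X)) \<partial>?Q)"
    using \<gamma>(3) tail_bound_nonneg[OF \<eta>] by (simp add: failure_bound_def sum_ennreal)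
  also have "\<dots> = (\<Sum>k<N. \<integral>\<^sup>+X. ennreal (?t k X) \<partial>?Q)"
  proof (rule nn_integral_sum)
    fix k assume "k \<in> {..<N}"
    then show "(\<lambda>X. ennreal (?t k X)) \<in> borel_measurable ?Q"
      by (intro measurable_compose[OF _ measurable_ennreal] tail_bound_measurable permutes_less[OF prm]) simp
  qed
  also have "\<dots> \<le> (\<Sum>k<N. ennreal (exp (- ((r/2)^d * (real N * \<gamma>^2 / 64)))))"
    by (rule sum_mono) (use bound in auto)
  also have "\<dots> = ennreal (real N * exp (- ((r/2)^d * (real N * \<gamma>^2 / 64))))"
    by (subst sum_ennreal) auto
  finally show ?thesis .
qed

lemma failure_bound_measurable:
  assumes "prm permutes {..<N}"
  shows "failure_bound d r w \<eta> N prm \<in> borel_measurable (PiM {..<N} (\<lambda>_. unif_ball d))"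
  unfolding failure_bound_def[abs_def]
  by (intro borel_measurable_sum tail_bound_measurable permutes_less[OF assms]) auto

text \<open>The failure bound holds for each permutation, hence for the average \<open>b\<close>
  over permutations. With arbitrary \<open>q\<close> and \<open>tb\<close> the integrand of
  \<open>success_prob\<close> may fail to be measurable, so additivity is applied to the measurable
  \<open>b\<close> and \<open>1 - b\<close>, and only monotonicity to
  \<open>success_prob\<close>.\<close>

lemma success_prob_ge:
  assumes d: "d \<ge> 1" and r: "0 < r" "144 * r * sqrt (real d) \<le> \<gamma>" and \<gamma>: "0 < \<gamma>" "\<gamma> \<le> 1/2" "\<gamma> = 1/2 - \<eta>"
    and w: "(\<Sum>j<d. (w j)^2) = 1" and N: "N \<ge> 2"
    and q: "\<And>X j. j < N \<Longrightarrow> 1 - \<eta> \<le> q X j \<and> q X j \<le> 1"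
    and \<delta>: "0 \<le> \<delta>" "real N * exp (- ((r/2)^d * (real N * \<gamma>^2 / 64))) \<le> \<delta>"
  shows "success_prob d r w N q tb \<ge> ennreal (1 - \<delta>)"
proof -
  interpret Q: prob_space "PiM {..<N} (\<lambda>_. unif_ball d)"
    by (rule prob_space_PiM) (rule prob_space_unif_ball[OF d])
  let ?Q = "PiM {..<N} (\<lambda>_. unif_ball d)"
  let ?P = "{p. p permutes {..<N}}"
  let ?S = "{..<N} \<rightarrow>\<^sub>E (UNIV :: bool set)"
  have \<eta>: "0 \<le> \<eta>" "\<eta> < 1/2" using \<gamma> by auto
  define b where "b X = (\<Sum>prm\<in>?P. 1 / fact N * failure_bound d r w \<eta> N prm X)" for X
  have fb0: "failure_bound d r w \<eta> N prm X \<ge> 0" for prm X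
    unfolding failure_bound_def using \<eta> by (intro sum_nonneg tail_bound_nonneg) auto
  have cardP: "card ?P = fact N" by (rule card_permutations) auto
  have b0: "b X \<ge> 0" for X unfolding b_def using fb0 by (intro sum_nonneg) auto
  have bm: "b \<in> borel_measurable ?Q"
    unfolding b_def[abs_def]
    by (intro borel_measurable_sum borel_measurable_times borel_measurable_const failure_bound_measurable) auto
  have "ennreal (b X) = (\<Sum>prm\<in>?P. ennreal (1 / fact N) * ennreal (failure_bound d r w \<eta> N prm X))" for X
  proof -
    have "(\<Sum>prm\<in>?P. ennreal (1 / fact N) * ennreal (failure_bound d r w \<eta> N prm X))
        = (\<Sum>prm\<in>?P. ennreal (1 / fact N * failure_bound d r w \<eta> N prm X))"
      by (rule sum.cong[OF refl ennreal_mult[symmetric]]) (use fb0 in auto)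
    also have "\<dots> = ennreal (b X)"
      unfolding b_def by (rule sum_ennreal) (use fb0 in auto)
    finally show ?thesis by simp
  qed
  then have "(\<integral>\<^sup>+X. ennreal (b X) \<partial>?Q) = (\<integral>\<^sup>+X. (\<Sum>prm\<in>?P. ennreal (1 / fact N) * ennreal (failure_bound d r w \<eta> N prm X)) \<partial>?Q)"
    by simp
  also have "\<dots> = (\<Sum>prm\<in>?P. ennreal (1 / fact N) * (\<integral>\<^sup>+X. ennreal (failure_bound d r w \<eta> N prm X) \<partial>?Q))"
  proof -
    have [measurable]: "failure_bound d r w \<eta> N prm \<in> borel_measurable ?Q" if "prm \<in> ?P" for prm
      using failure_bound_measurable that by auto
    show ?thesis
      by (subst nn_integral_sum) (auto intro!: sum.cong nn_integral_cmult)
  qed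
  also have "\<dots> \<le> (\<Sum>prm\<in>?P. ennreal (1 / fact N) * ennreal \<delta>)"
  proof (intro sum_mono mult_left_mono)
    fix prm assume "prm \<in> ?P"
    then have "(\<integral>\<^sup>+X. ennreal (failure_bound d r w \<eta> N prm X) \<partial>?Q)
        \<le> ennreal (real N * exp (- ((r/2)^d * (real N * \<gamma>^2 / 64))))"
      by (intro expected_failure_bound[OF d r \<gamma> w _ N]) simp
    also have "\<dots> \<le> ennreal \<delta>" by (rule ennreal_leI[OF \<delta>(2)])
    finally show "(\<integral>\<^sup>+X. ennreal (failure_bound d r w \<eta> N prm X) \<partial>?Q) \<le> ennreal \<delta>" .
  qed simp
  also have "\<dots> = ennreal \<delta>"
    using \<delta> by (simp add: cardP ennreal_mult[symmetric] ennreal_of_nat_eq_real_of_nat)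
  finally have ib: "(\<integral>\<^sup>+X. ennreal (b X) \<partial>?Q) \<le> ennreal \<delta>" .
  have lower: "1 - b X \<le> (\<Sum>s0\<in>?S. \<Sum>prm\<in>?P. state_prob d w N X (q X) s0 * (1 / fact N) *
           (if good_event d r w N X prm (tb X s0 prm) s0 then 1 else 0))" for X
  proof -
    have "1 - b X = (\<Sum>prm\<in>?P. 1 / fact N * (1 - failure_bound d r w \<eta> N prm X))"
      by (simp add: b_def right_diff_distrib sum_subtractf cardP)
    also have "\<dots> \<le> (\<Sum>prm\<in>?P. 1 / fact N * (\<Sum>s0\<in>?S. state_prob d w N X (q X) s0 *
        of_bool (good_event d r w N X prm (tb X s0 prm) s0)))"
    proof (intro sum_mono mult_left_mono)
      fix prm assume "prm \<in> ?P"
      then show "1 - failure_bound d r w \<eta> N prm X \<le> (\<Sum>s0\<in>?S. state_prob d w N X (q X) s0 *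
        of_bool (good_event d r w N X prm (tb X s0 prm) s0))"
        using r(1) by (intro prob_good_event_ge w q \<eta>) auto
    qed simp
    also have "\<dots> = (\<Sum>prm\<in>?P. \<Sum>s0\<in>?S. state_prob d w N X (q X) s0 * (1 / fact N) *
           (if good_event d r w N X prm (tb X s0 prm) s0 then 1 else 0))"
      by (simp add: sum_distrib_left of_bool_def mult_ac)
    also have "\<dots> = (\<Sum>s0\<in>?S. \<Sum>prm\<in>?P. state_prob d w N X (q X) s0 * (1 / fact N) *
           (if good_event d r w N X prm (tb X s0 prm) s0 then 1 else 0))"
      by (rule sum.swap)
    finally show ?thesis .
  qed
  have "1 = (\<integral>\<^sup>+X. 1 \<partial>?Q)" by (simp add: Q.emeasure_space_1)
  \<comment> \<open>Only an inequality holds here, since \<open>ennreal\<close> sends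
    \<open>1 - b X\<close> to 0 where \<open>b X > 1\<close>.\<close>
  also have "\<dots> \<le> (\<integral>\<^sup>+X. ennreal (1 - b X) + ennreal (b X) \<partial>?Q)"
  proof (rule nn_integral_mono)
    fix X
    have "1 \<le> max 0 (1 - b X) + b X" by simp
    then have "ennreal 1 \<le> ennreal (max 0 (1 - b X) + b X)" by (rule ennreal_leI)
    also have "\<dots> = ennreal (max 0 (1 - b X)) + ennreal (b X)" using b0 by (intro ennreal_plus) auto
    finally show "1 \<le> ennreal (1 - b X) + ennreal (b X)" by simp
  qed
  also have "\<dots> = (\<integral>\<^sup>+X. ennreal (1 - b X) \<partial>?Q) + (\<integral>\<^sup>+X. ennreal (b X) \<partial>?Q)"
    by (intro nn_integral_add measurable_compose[OF _ measurable_ennreal] borel_measurable_diff borel_measurable_const bm)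
  also have "\<dots> \<le> success_prob d r w N q tb + ennreal \<delta>"
    unfolding success_prob_def
    by (intro add_mono ib nn_integral_mono ennreal_leI lower)
  finally have "1 - ennreal \<delta> \<le> success_prob d r w N q tb"
    by (simp add: ennreal_minus_le_iff add.commute)
  then show ?thesis using \<delta>(1) by (simp add: ennreal_minus flip: ennreal_1)
qed

theorem theorem5:
  shows "\<exists>c3 c4 :: real. c3 > 0 \<and> c4 > 0 \<and>
    (\<forall>(d::nat) (N::nat) (r::real) (\<eta>::real) (\<delta>::real) (w :: nat \<Rightarrow> real)
       (q :: (nat \<Rightarrow> nat \<Rightarrow> real) \<Rightarrow> nat \<Rightarrow> real)
       (tb :: (nat \<Rightarrow> nat \<Rightarrow> real) \<Rightarrow> (nat \<Rightarrow> bool) \<Rightarrow> (nat \<Rightarrow> nat) \<Rightarrow> nat \<Rightarrow> bool).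
      let \<gamma> = 1/2 - \<eta> in
      d \<ge> 1 \<longrightarrow> (\<Sum>j<d. (w j)^2) = 1 \<longrightarrow>
      0 \<le> \<eta> \<longrightarrow> \<eta> < 1/2 \<longrightarrow> 0 < \<delta> \<longrightarrow> \<delta> < 1 \<longrightarrow>
      0 < r \<longrightarrow> r \<le> \<gamma> / (c3 * sqrt (real d)) \<longrightarrow>
      real N \<ge> c4 / ((r/2)^d * \<gamma>^2) * ln (1 / (r^d * \<gamma> * \<delta>)) \<longrightarrow>
      (\<forall>X i. i < N \<longrightarrow> 1 - \<eta> \<le> q X i \<and> q X i \<le> 1) \<longrightarrow>
      success_prob d r w N q tb \<ge> ennreal (1 - \<delta>))"
proof (rule exI[of _ 144], rule exI[of _ 512], intro conjI allI)
  fix d N :: nat and r \<eta> \<delta> :: real and w :: "nat \<Rightarrow> real"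
    and q :: "(nat \<Rightarrow> nat \<Rightarrow> real) \<Rightarrow> nat \<Rightarrow> real"
    and tb :: "(nat \<Rightarrow> nat \<Rightarrow> real) \<Rightarrow> (nat \<Rightarrow> bool) \<Rightarrow> (nat \<Rightarrow> nat) \<Rightarrow> nat \<Rightarrow> bool"
  show "let \<gamma> = 1/2 - \<eta> in
      d \<ge> 1 \<longrightarrow> (\<Sum>j<d. (w j)^2) = 1 \<longrightarrow>
      0 \<le> \<eta> \<longrightarrow> \<eta> < 1/2 \<longrightarrow> 0 < \<delta> \<longrightarrow> \<delta> < 1 \<longrightarrow>
      0 < r \<longrightarrow> r \<le> \<gamma> / (144 * sqrt (real d)) \<longrightarrow>
      real N \<ge> 512 / ((r/2)^d * \<gamma>^2) * ln (1 / (r^d * \<gamma> * \<delta>)) \<longrightarrow>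
      (\<forall>X i. i < N \<longrightarrow> 1 - \<eta> \<le> q X i \<and> q X i \<le> 1) \<longrightarrow>
      success_prob d r w N q tb \<ge> ennreal (1 - \<delta>)"
    unfolding Let_def
  proof (intro impI)
    define \<gamma> where "\<gamma> = 1/2 - \<eta>"
    assume d: "d \<ge> 1" and w: "(\<Sum>j<d. (w j)^2) = 1" and \<eta>: "0 \<le> \<eta>" "\<eta> < 1/2"
      and \<delta>: "0 < \<delta>" "\<delta> < 1" and r: "0 < r" "r \<le> (1/2 - \<eta>) / (144 * sqrt (real d))"
      and N: "real N \<ge> 512 / ((r/2)^d * (1/2 - \<eta>)^2) * ln (1 / (r^d * (1/2 - \<eta>) * \<delta>))"
      and q: "\<forall>X i. i < N \<longrightarrow> 1 - \<eta> \<le> q X i \<and> q X i \<le> 1"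
    have \<gamma>: "0 < \<gamma>" "\<gamma> \<le> 1/2" using \<eta> by (auto simp: \<gamma>_def)
    have sd: "1 \<le> sqrt (real d)" using d by simp
    have r': "144 * r * sqrt (real d) \<le> \<gamma>"
      using r(2) sd by (simp add: \<gamma>_def field_simps)
    have "r * 1 \<le> r * sqrt (real d)" using r(1) sd by (intro mult_left_mono) auto
    then have "r \<le> 1/8" using r' \<gamma> by linarith
    note tail = sample_size_tail[OF d r(1) this \<gamma> \<delta> N[folded \<gamma>_def]]
    show "success_prob d r w N q tb \<ge> ennreal (1 - \<delta>)"
      by (rule success_prob_ge[OF d r(1) r' \<gamma> \<gamma>_def w _ _ _ tail(2)]) (use tail(1) q \<delta> in auto)
  qed
qed auto

end
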